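(* Let $1\le p\le\infty$. The functor $\mathcal{D}_p$, which assigns to each metric pair $(X,A)$ the pointed space of persistence diagrams $(\mathcal{D}_p(X,A),\sigma_\varnothing)$ (a pointed metric space if $p<\infty$, a pointed pseudometric space if $p=\infty$), is sequentially continuous with respect to the Gromov--Hausdorff convergence of metric pairs if and only if $p=\infty$. Here sequential continuity means: whenever a sequence of metric pairs $(X_i,A_i)$ converges to a metric pair $(X,A)$ in the Gromov--Hausdorff sense for metric pairs, the sequence $(\mathcal{D}_p(X_i,A_i),\sigma_\varnothing^i)$ converges to $(\mathcal{D}_p(X,A),\sigma_\varnothing)$ in the pointed Gromov--Hausdorff sense, where $\sigma^i_\varnothing$ is the empty diagram of $\mathcal{D}_p(X_i,A_i)$.
   Context: A metric pair $(X,A)$ is a metric space $(X,d)$ together with a non-empty closed subset $A\subseteq X$. Persistence diagrams: for a set $Y$, let $\widetilde{\mathcal D}(Y)$ be the set of countable (finite or countably infinite) multisets of elements of $Y$; the sum of two multisets is their disjoint union. For $\widetilde\sigma,\widetilde\tau\in\widetilde{\mathcal D}(X)$ put $\widetilde d_p(\widetilde\sigma,\widetilde\tau)=\inf_\phi\big(\sum_{x\in\widetilde\sigma}d(x,\phi(x))^p\big)^{1/p}$ if $p<\infty$ and $\widetilde d_\infty(\widetilde\sigma,\widetilde\tau)=\inf_\phi\sup_{x\in\widetilde\sigma}d(x,\phi(x))$, the infimum being over all bijections $\phi\colon\widetilde\sigma\to\widetilde\tau$ of multisets ($\inf\varnothing=\infty$). Write $\widetilde\sigma\sim_A\widetilde\tau$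 if $\widetilde\sigma+\widetilde\alpha=\widetilde\tau+\widetilde\beta$ for some $\widetilde\alpha,\widetilde\beta\in\widetilde{\mathcal D}(A)$; let $\mathcal D(X,A)=\widetilde{\mathcal D}(X)/\!\sim_A$, with $\sigma$ the class of $\widetilde\sigma$ and $\sigma_\varnothing$ the class of the empty multiset (the empty diagram). Put $d_p(\sigma,\tau)=\inf_{\widetilde\alpha,\widetilde\beta\in\widetilde{\mathcal D}(A)}\widetilde d_p(\widetilde\sigma+\widetilde\alpha,\widetilde\tau+\widetilde\beta)$ and $\mathcal D_p(X,A)=\{\sigma\in\mathcal D(X,A): d_p(\sigma,\sigma_\varnothing)<\infty\}$, equipped with $d_p$. Gromov--Hausdorff convergence of metric pairs: $(X_i,A_i)\to(X,A)$ if there are positive sequences $\varepsilon_i\searrow0$, $R_i\nearrow\infty$ and maps $f_i\colon\overline B_{R_i}(A_i)\to X$ such that (1) $|d_{X_i}(x,y)-d_X(f_i(x),f_i(y))|\le\varepsilon_i$ for all $x,y\in\overline B_{R_i}(A_i)$; (2) the Hausdorff distance in $X$ satisfies $d_H(f_i(A_i),A)\le\varepsilon_i$; (3) $\overline B_{R_i}(A)\subset\overline B_{\varepsilon_i}(f_i(\overline B_{R_i}(A_i)))$. Here $\overline B_R(S)$ denotes the set of points at distance at most $R$ from the set $S$. Pointed Gromov--Hausdorff convergence of pointed (pseudo)metric spaces $(D_i,\sigma_i)\to(D,\sigma)$: the same definition with $A_i,A$ replaced by $\{\sigma_i\},\{\sigma\}$ (condition (2) becoming $d(f_i(\sigma_i),\sigma)\le\varepsilon_i$)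 and with pseudometrics allowed. *)

theory Defs
  imports "HOL-Analysis.Analysis" "HOL-Library.Extended_Nat" "HOL-Library.Function_Algebras"
begin

section \<open>Metric pairs and Gromov--Hausdorff convergence\<close>

definition metric_pair :: "'a set \<Rightarrow> ('a \<Rightarrow> 'a \<Rightarrow> real) \<Rightarrow> 'a set \<Rightarrow> bool" where
  "metric_pair X d A \<longleftrightarrow>
     Metric_space X d \<and> A \<noteq> {} \<and> closedin (Metric_space.mtopology X d) A"

text \<open>
  The following notions are meant for nonnegative symmetric \<open>d\<close>; they use neither the axiom that
  distinct points have positive distance nor the triangle inequality, so they also make sense for
  pseudometrics. Infima and suprema are taken in \<^typ>\<open>ennreal\<close>, so that the distance to the
  empty set is \<open>\<infinity>\<close>.
\<close>

definition dist_to_set :: "('a \<Rightarrow> 'a \<Rightarrow> real) \<Rightarrow> 'a \<Rightarrow> 'a set \<Rightarrow> ennreal" where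
  "dist_to_set d x S = (INF s\<in>S. ennreal (d x s))"

definition cball_set :: "'a set \<Rightarrow> ('a \<Rightarrow> 'a \<Rightarrow> real) \<Rightarrow> real \<Rightarrow> 'a set \<Rightarrow> 'a set" where
  "cball_set X d r S = {x \<in> X. dist_to_set d x S \<le> ennreal r}"

definition hausdorff_dist :: "('a \<Rightarrow> 'a \<Rightarrow> real) \<Rightarrow> 'a set \<Rightarrow> 'a set \<Rightarrow> ennreal" where
  "hausdorff_dist d S T = max (SUP s\<in>S. dist_to_set d s T) (SUP t\<in>T. dist_to_set d t S)"

definition gh_converges ::
  "(nat \<Rightarrow> 'a set) \<Rightarrow> (nat \<Rightarrow> 'a \<Rightarrow> 'a \<Rightarrow> real) \<Rightarrow> (nat \<Rightarrow> 'a set) \<Rightarrow>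
   'b set \<Rightarrow> ('b \<Rightarrow> 'b \<Rightarrow> real) \<Rightarrow> 'b set \<Rightarrow> bool" where
  "gh_converges Xs ds As X d A \<longleftrightarrow>
     (\<exists>\<epsilon> R f.
        (\<forall>i. 0 < \<epsilon> i) \<and> decseq \<epsilon> \<and> \<epsilon> \<longlonglongrightarrow> 0 \<and>
        (\<forall>i. 0 < R i) \<and> incseq R \<and> filterlim R at_top sequentially \<and>
        (\<forall>i. f i ` cball_set (Xs i) (ds i) (R i) (As i) \<subseteq> X \<and>
             (\<forall>x \<in> cball_set (Xs i) (ds i) (R i) (As i).
              \<forall>y \<in> cball_set (Xs i) (ds i) (R i) (As i).
                \<bar>ds i x y - d (f i x) (f i y)\<bar> \<le> \<epsilon> i) \<and>
             hausdorff_dist d (f i ` As i) A \<le> ennreal (\<epsilon> i) \<and>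
             cball_set X d (R i) A
               \<subseteq> cball_set X d (\<epsilon> i) (f i ` cball_set (Xs i) (ds i) (R i) (As i))))"

definition pointed_gh_converges ::
  "(nat \<Rightarrow> 'a set) \<Rightarrow> (nat \<Rightarrow> 'a \<Rightarrow> 'a \<Rightarrow> real) \<Rightarrow> (nat \<Rightarrow> 'a) \<Rightarrow>
   'b set \<Rightarrow> ('b \<Rightarrow> 'b \<Rightarrow> real) \<Rightarrow> 'b \<Rightarrow> bool" where
  "pointed_gh_converges Xs ds as X d a \<longleftrightarrow> gh_converges Xs ds (\<lambda>i. {as i}) X d {a}"

lemma hausdorff_dist_singleton:
  assumes "d x y = d y x"
  shows "hausdorff_dist d {x} {y} = ennreal (d x y)"
  using assms by (simp add: hausdorff_dist_def dist_to_set_def)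


section \<open>Countable multisets\<close>

text \<open>
  A countable multiset is given by its multiplicity function, with values in \<^typ>\<open>enat\<close>: an
  element may occur countably infinitely often. The sum of multisets is the pointwise sum
  and the empty multiset is \<open>0\<close>.
\<close>

definition cmultisets :: "'a set \<Rightarrow> ('a \<Rightarrow> enat) set" where
  "cmultisets Y = {m. {x. m x \<noteq> 0} \<subseteq> Y \<and> countable {x. m x \<noteq> 0}}"

text \<open>The occurrences of elements in a multiset: \<open>x\<close> is listed \<open>m x\<close> times.\<close>

definition occs :: "('a \<Rightarrow> enat) \<Rightarrow> ('a \<times> nat) set" where
  "occs m = {(x, k). enat k < m x}"


section \<open>The distance between multisets\<close>

text \<open>For \<open>a > 0\<close>, the power \<open>x\<^sup>a\<close> with \<open>\<infinity>\<^sup>a = \<infinity>\<close>.\<close>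

definition ennreal_powr :: "ennreal \<Rightarrow> real \<Rightarrow> ennreal" where
  "ennreal_powr x a = (if x = \<infinity> then \<infinity> else ennreal (enn2real x powr a))"

definition matching_cost ::
  "ereal \<Rightarrow> ('a \<Rightarrow> 'a \<Rightarrow> real) \<Rightarrow> ('a \<Rightarrow> enat) \<Rightarrow> ('a \<times> nat \<Rightarrow> 'a \<times> nat) \<Rightarrow> ennreal" where
  "matching_cost p d s \<phi> =
     (if p = \<infinity> then (SUP u\<in>occs s. ennreal (d (fst u) (fst (\<phi> u))))
      else ennreal_powr (\<Sum>\<^sub>\<infinity>u\<in>occs s. ennreal (d (fst u) (fst (\<phi> u)) powr real_of_ereal p))
             (1 / real_of_ereal p))"

definition mset_dist ::
  "ereal \<Rightarrow> ('a \<Rightarrow> 'a \<Rightarrow> real) \<Rightarrow> ('a \<Rightarrow> enat) \<Rightarrow> ('a \<Rightarrow> enat) \<Rightarrow> ennreal" where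
  "mset_dist p d s t = (INF \<phi>\<in>{\<phi>. bij_betw \<phi> (occs s) (occs t)}. matching_cost p d s \<phi>)"


section \<open>Spaces of persistence diagrams\<close>

definition dgm_rel :: "'a set \<Rightarrow> 'a set \<Rightarrow> (('a \<Rightarrow> enat) \<times> ('a \<Rightarrow> enat)) set" where
  "dgm_rel X A = {(s, t). s \<in> cmultisets X \<and> t \<in> cmultisets X \<and>
                    (\<exists>\<alpha>\<in>cmultisets A. \<exists>\<beta>\<in>cmultisets A. s + \<alpha> = t + \<beta>)}"

definition dgms :: "'a set \<Rightarrow> 'a set \<Rightarrow> ('a \<Rightarrow> enat) set set" where
  "dgms X A = cmultisets X // dgm_rel X A"

definition empty_dgm :: "'a set \<Rightarrow> 'a set \<Rightarrow> ('a \<Rightarrow> enat) set" where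
  "empty_dgm X A = dgm_rel X A `` {0}"

text \<open>
  The distance is computed on arbitrary representatives; \<open>dgm_edist_class\<close> below shows that
  their choice does not matter.
\<close>

definition dgm_edist ::
  "ereal \<Rightarrow> ('a \<Rightarrow> 'a \<Rightarrow> real) \<Rightarrow> 'a set \<Rightarrow> ('a \<Rightarrow> enat) set \<Rightarrow> ('a \<Rightarrow> enat) set \<Rightarrow> ennreal" where
  "dgm_edist p d A \<sigma> \<tau> =
     (INF \<alpha>\<in>cmultisets A. INF \<beta>\<in>cmultisets A.
        mset_dist p d ((SOME s. s \<in> \<sigma>) + \<alpha>) ((SOME t. t \<in> \<tau>) + \<beta>))"

definition dgm_space ::
  "ereal \<Rightarrow> 'a set \<Rightarrow> ('a \<Rightarrow> 'a \<Rightarrow> real) \<Rightarrow> 'a set \<Rightarrow> ('a \<Rightarrow> enat) set set" where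
  "dgm_space p X d A = {\<sigma> \<in> dgms X A. dgm_edist p d A \<sigma> (empty_dgm X A) < \<infinity>}"

text \<open>
  On \<^const>\<open>dgm_space\<close> the distance is finite (\<open>dgm_edist_finite\<close> below), so
  that \<^const>\<open>enn2real\<close> loses nothing there.
\<close>

definition dgm_dist ::
  "ereal \<Rightarrow> ('a \<Rightarrow> 'a \<Rightarrow> real) \<Rightarrow> 'a set \<Rightarrow> ('a \<Rightarrow> enat) set \<Rightarrow> ('a \<Rightarrow> enat) set \<Rightarrow> real" where
  "dgm_dist p d A \<sigma> \<tau> = enn2real (dgm_edist p d A \<sigma> \<tau>)"


section \<open>Well-definedness\<close>

lemma zero_cmultisets [simp]: "0 \<in> cmultisets Y"
  by (simp add: cmultisets_def)

lemma plus_cmultisets: "s \<in> cmultisets Y \<Longrightarrow> t \<in> cmultisets Y \<Longrightarrow> s + t \<in> cmultisets Y"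
proof -
  assume st: "s \<in> cmultisets Y" "t \<in> cmultisets Y"
  have "{x. (s + t) x \<noteq> 0} = {x. s x \<noteq> 0} \<union> {x. t x \<noteq> 0}"
    by auto
  with st show ?thesis
    by (auto simp: cmultisets_def)
qed

lemma cmultisets_mono: "A \<subseteq> X \<Longrightarrow> cmultisets A \<subseteq> cmultisets X"
  by (auto simp: cmultisets_def)

lemma equiv_dgm_rel: "equiv (cmultisets X) (dgm_rel X A)"
proof (rule equivI)
  show "dgm_rel X A \<subseteq> cmultisets X \<times> cmultisets X"
    by (auto simp: dgm_rel_def)
  show "refl_on (cmultisets X) (dgm_rel X A)"
  proof (rule refl_onI)
    fix s assume "s \<in> cmultisets X"
    then show "(s, s) \<in> dgm_rel X A"
      unfolding dgm_rel_def using zero_cmultisets by blast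
  qed
  show "sym (dgm_rel X A)"
    by (rule symI) (unfold dgm_rel_def, clarify, metis)
  show "trans (dgm_rel X A)"
  proof (rule transI)
    fix s t u assume "(s, t) \<in> dgm_rel X A" "(t, u) \<in> dgm_rel X A"
    then obtain \<alpha> \<beta> \<alpha>' \<beta>' where
      st: "s \<in> cmultisets X" "u \<in> cmultisets X"
        "\<alpha> \<in> cmultisets A" "\<beta> \<in> cmultisets A" "s + \<alpha> = t + \<beta>"
        "\<alpha>' \<in> cmultisets A" "\<beta>' \<in> cmultisets A" "t + \<alpha>' = u + \<beta>'"
      by (auto simp: dgm_rel_def)
    have "s + (\<alpha> + \<alpha>') = (t + \<beta>) + \<alpha>'"
      using st(5) by (simp add: add.assoc[symmetric])
    also have "\<dots> = (t + \<alpha>') + \<beta>"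
      by (simp add: ac_simps)
    also have "\<dots> = u + (\<beta>' + \<beta>)"
      using st(8) by (simp add: ac_simps)
    finally show "(s, u) \<in> dgm_rel X A"
      using st plus_cmultisets unfolding dgm_rel_def by blast
  qed
qed

lemma occs_plus:
  "\<exists>h. bij_betw h (occs (a + b)) (occs a <+> occs b) \<and>
       (\<forall>u. fst u = fst (case_sum id id (h u)))"
proof -
  let ?K = "\<lambda>n. {k. enat k < n}"
  have "\<exists>g. bij_betw g (?K (m + n)) (?K m <+> ?K n)" for m n
  proof (cases "m = \<infinity> \<or> n = \<infinity>")
    case True
    then have 1: "?K (m + n) = UNIV" and 2: "?K m = UNIV \<or> ?K n = UNIV"
      by auto
    from 2 have "infinite (?K m <+> ?K n)" "countable (?K m <+> ?K n)"
      by auto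
    with 1 show ?thesis
      using bij_betw_inv_into[OF to_nat_on_infinite] by metis
  next
    case False
    then obtain i j where mn: "m = enat i" "n = enat j"
      by auto
    then have "?K m = {..<i}" "?K n = {..<j}" "?K (m + n) = {..<i + j}"
      by auto
    then show ?thesis
      by (auto intro!: finite_same_card_bij simp: card_Plus)
  qed
  then obtain g where g: "\<And>m n. bij_betw (g m n) (?K (m + n)) (?K m <+> ?K n)"
    by metis
  define h where "h = (\<lambda>(x, k). map_sum (Pair x) (Pair x) (g (a x) (b x) k))"
  have "inj_on h (occs (a + b))"
  proof (rule inj_onI)
    fix u v assume uv: "u \<in> occs (a + b)" "v \<in> occs (a + b)" "h u = h v"
    obtain x k y l where *: "u = (x, k)" "v = (y, l)"
      by fastforce
    have "x = y" "g (a x) (b x) k = g (a y) (b y) l"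
      using uv(3) unfolding h_def *
      by (auto simp: map_sum_def split: sum.splits)
    then show "u = v"
      using uv g[of "a x" "b x"] by (auto simp: * occs_def bij_betw_def inj_on_def)
  qed
  moreover have "h ` occs (a + b) = occs a <+> occs b"
  proof (intro equalityI subsetI)
    fix w assume "w \<in> h ` occs (a + b)"
    then obtain x k where *: "enat k < a x + b x" "w = h (x, k)"
      by (auto simp: occs_def)
    then have "g (a x) (b x) k \<in> ?K (a x) <+> ?K (b x)"
      using g[of "a x" "b x"] by (auto simp: bij_betw_def)
    then show "w \<in> occs a <+> occs b"
      by (auto simp: * h_def occs_def)
  next
    fix w assume "w \<in> occs a <+> occs b"
    then obtain x l where *: "l \<in> ?K (a x) <+> ?K (b x)" "w = map_sum (Pair x) (Pair x) l"
      by (force simp: occs_def)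
    from *(1) have "l \<in> g (a x) (b x) ` ?K (a x + b x)"
      using g[of "a x" "b x"] by (simp only: bij_betw_def)
    then obtain k where "enat k < a x + b x" "l = g (a x) (b x) k"
      by blast
    then have "(x, k) \<in> occs (a + b)" "w = h (x, k)"
      by (simp_all add: * h_def occs_def)
    then show "w \<in> h ` occs (a + b)"
      by blast
  qed
  moreover have "fst u = fst (case_sum id id (h u))" for u
    by (auto simp: h_def split: sum.splits prod.splits simp: map_sum_def)
  ultimately show ?thesis
    unfolding bij_betw_def by blast
qed

lemma combine_matchings:
  assumes \<phi>: "bij_betw \<phi> (occs a) (occs b)" and \<psi>: "bij_betw \<psi> (occs c) (occs e)"
  obtains \<theta> where "bij_betw \<theta> (occs (a + c)) (occs (b + e))"
    and "\<And>F :: 'a \<Rightarrow> 'a \<Rightarrow> ennreal.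
           (\<Sum>\<^sub>\<infinity>u\<in>occs (a + c). F (fst u) (fst (\<theta> u))) =
           (\<Sum>\<^sub>\<infinity>u\<in>occs a. F (fst u) (fst (\<phi> u))) + (\<Sum>\<^sub>\<infinity>u\<in>occs c. F (fst u) (fst (\<psi> u)))"
    and "\<And>F :: 'a \<Rightarrow> 'a \<Rightarrow> ennreal.
           (SUP u\<in>occs (a + c). F (fst u) (fst (\<theta> u))) =
           sup (SUP u\<in>occs a. F (fst u) (fst (\<phi> u))) (SUP u\<in>occs c. F (fst u) (fst (\<psi> u)))"
proof -
  obtain h where h: "bij_betw h (occs (a + c)) (occs a <+> occs c)"
    "\<And>u. fst u = fst (case_sum id id (h u))"
    using occs_plus[of a c] by (elim exE conjE) (rule that, assumption, erule spec)
  obtain g where g: "bij_betw g (occs (b + e)) (occs b <+> occs e)"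
    "\<And>u. fst u = fst (case_sum id id (g u))"
    using occs_plus[of b e] by (elim exE conjE) (rule that, assumption, erule spec)
  define \<theta> where "\<theta> = inv_into (occs (b + e)) g \<circ> (map_sum \<phi> \<psi> \<circ> h)"
  have m: "bij_betw (map_sum \<phi> \<psi>) (occs a <+> occs c) (occs b <+> occs e)"
  proof (rule bij_betw_imageI)
    show "inj_on (map_sum \<phi> \<psi>) (occs a <+> occs c)"
      using bij_betw_imp_inj_on[OF \<phi>] bij_betw_imp_inj_on[OF \<psi>]
      by (intro inj_onI) (elim PlusE; simp add: inj_on_eq_iff)
    have "map_sum \<phi> \<psi> ` (occs a <+> occs c) = \<phi> ` occs a <+> \<psi> ` occs c"
      unfolding Plus_def image_Un image_image by simp
    then show "map_sum \<phi> \<psi> ` (occs a <+> occs c) = occs b <+> occs e"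
      by (simp only: bij_betw_imp_surj_on[OF \<phi>] bij_betw_imp_surj_on[OF \<psi>])
  qed
  have bij: "bij_betw \<theta> (occs (a + c)) (occs (b + e))"
    unfolding \<theta>_def
    by (rule bij_betw_trans[OF bij_betw_trans[OF h(1) m] bij_betw_inv_into[OF g(1)]])
  have fst_\<theta>: "fst (\<theta> u) = fst (case_sum \<phi> \<psi> (h u))" if "u \<in> occs (a + c)" for u
  proof -
    have "map_sum \<phi> \<psi> (h u) \<in> occs b <+> occs e"
      using bij_betw_apply[OF m bij_betw_apply[OF h(1) that]] .
    then have "g (\<theta> u) = map_sum \<phi> \<psi> (h u)"
      using g(1) by (auto simp: \<theta>_def bij_betw_def f_inv_into_f)
    then show ?thesis
      using g(2)[of "\<theta> u"] by (cases "h u") auto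
  qed
  have Plus: "occs a <+> occs c = Inl ` occs a \<union> Inr ` occs c"
    by (simp add: Plus_def)
  show ?thesis
  proof (rule that[OF bij])
    fix F :: "'a \<Rightarrow> 'a \<Rightarrow> ennreal"
    let ?G = "\<lambda>w. F (fst (case_sum id id w)) (fst (case_sum \<phi> \<psi> w))"
    have FG: "F (fst u) (fst (\<theta> u)) = ?G (h u)" if "u \<in> occs (a + c)" for u
      using fst_\<theta>[OF that] h(2)[of u] by simp
    have "(\<Sum>\<^sub>\<infinity>u\<in>occs (a + c). F (fst u) (fst (\<theta> u))) = (\<Sum>\<^sub>\<infinity>u\<in>occs (a + c). ?G (h u))"
      by (rule infsum_cong) (rule FG)
    also have "\<dots> = (\<Sum>\<^sub>\<infinity>w\<in>occs a <+> occs c. ?G w)"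
      by (rule infsum_reindex_bij_betw[OF h(1)])
    also have "\<dots> = (\<Sum>\<^sub>\<infinity>w\<in>Inl ` occs a. ?G w) + (\<Sum>\<^sub>\<infinity>w\<in>Inr ` occs c. ?G w)"
      unfolding Plus by (rule infsum_Un_disjoint) (auto intro: nonneg_summable_on_complete)
    also have "\<dots> = (\<Sum>\<^sub>\<infinity>u\<in>occs a. F (fst u) (fst (\<phi> u))) + (\<Sum>\<^sub>\<infinity>u\<in>occs c. F (fst u) (fst (\<psi> u)))"
      by (subst (1 2) infsum_reindex) (auto simp: o_def)
    finally show "(\<Sum>\<^sub>\<infinity>u\<in>occs (a + c). F (fst u) (fst (\<theta> u))) = \<dots>" .
    have "(SUP u\<in>occs (a + c). F (fst u) (fst (\<theta> u))) = (SUP u\<in>occs (a + c). ?G (h u))"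
      by (rule SUP_cong) (auto simp: FG)
    also have "\<dots> = (SUP w\<in>h ` occs (a + c). ?G w)"
      by (simp only: image_image)
    also have "\<dots> = (SUP w\<in>occs a <+> occs c. ?G w)"
      using h(1) by (simp add: bij_betw_def)
    also have "\<dots> = sup (SUP u\<in>occs a. F (fst u) (fst (\<phi> u))) (SUP u\<in>occs c. F (fst u) (fst (\<psi> u)))"
      unfolding Plus by (simp add: SUP_union image_image)
    finally show "(SUP u\<in>occs (a + c). F (fst u) (fst (\<theta> u))) = \<dots>" .
  qed
qed

lemma mset_dist_add_common:
  assumes d: "\<And>x. c x \<noteq> 0 \<Longrightarrow> d x x = 0"
  shows "mset_dist p d (a + c) (b + c) \<le> mset_dist p d a b"
  unfolding mset_dist_def
proof (rule INF_greatest)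
  fix \<phi> assume "\<phi> \<in> {\<phi>. bij_betw \<phi> (occs a) (occs b)}"
  then have \<phi>: "bij_betw \<phi> (occs a) (occs b)"
    by simp
  obtain \<theta> where \<theta>: "bij_betw \<theta> (occs (a + c)) (occs (b + c))"
    and inf: "\<And>F :: 'a \<Rightarrow> 'a \<Rightarrow> ennreal.
           (\<Sum>\<^sub>\<infinity>u\<in>occs (a + c). F (fst u) (fst (\<theta> u))) =
           (\<Sum>\<^sub>\<infinity>u\<in>occs a. F (fst u) (fst (\<phi> u))) + (\<Sum>\<^sub>\<infinity>u\<in>occs c. F (fst u) (fst (id u)))"
    and sup: "\<And>F :: 'a \<Rightarrow> 'a \<Rightarrow> ennreal.
           (SUP u\<in>occs (a + c). F (fst u) (fst (\<theta> u))) =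
           sup (SUP u\<in>occs a. F (fst u) (fst (\<phi> u))) (SUP u\<in>occs c. F (fst u) (fst (id u)))"
    by (rule combine_matchings[OF \<phi> bij_betw_id[of "occs c"]]) blast
  have d0: "d (fst u) (fst u) = 0" if "u \<in> occs c" for u
    using that d[of "fst u"] by (cases "c (fst u)") (auto simp: occs_def zero_enat_def)
  have 1: "(\<Sum>\<^sub>\<infinity>u\<in>occs c. ennreal (d (fst u) (fst (id u)) powr r)) = 0" for r
    by (rule infsum_0) (simp add: d0)
  have 2: "(SUP u\<in>occs c. ennreal (d (fst u) (fst (id u)))) = 0"
    using d0 by (intro antisym SUP_least) auto
  have "matching_cost p d (a + c) \<theta> = matching_cost p d a \<phi>"
    unfolding matching_cost_def
      inf[of "\<lambda>x y. ennreal (d x y powr real_of_ereal p)"] sup[of "\<lambda>x y. ennreal (d x y)"] 1 2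
    by (simp add: sup_absorb1)
  moreover have "(INF \<phi>\<in>{\<phi>. bij_betw \<phi> (occs (a + c)) (occs (b + c))}. matching_cost p d (a + c) \<phi>)
      \<le> matching_cost p d (a + c) \<theta>"
    by (rule INF_lower) (simp add: \<theta>)
  ultimately show "(INF \<phi>\<in>{\<phi>. bij_betw \<phi> (occs (a + c)) (occs (b + c))}. matching_cost p d (a + c) \<phi>)
      \<le> matching_cost p d a \<phi>"
    by simp
qed

lemma INF_INF_lower:
  fixes f :: "'i \<Rightarrow> 'j \<Rightarrow> ennreal"
  shows "i \<in> I \<Longrightarrow> j \<in> J \<Longrightarrow> (INF i\<in>I. INF j\<in>J. f i j) \<le> f i j"
  by (meson INF_lower order_trans)

lemma dgm_edist_mono_rep:
  assumes A: "\<And>x. x \<in> A \<Longrightarrow> d x x = 0"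
    and s: "(s, s') \<in> dgm_rel X A" and t: "(t, t') \<in> dgm_rel X A"
  shows "(INF \<alpha>\<in>cmultisets A. INF \<beta>\<in>cmultisets A. mset_dist p d (s + \<alpha>) (t + \<beta>))
       \<le> (INF \<alpha>\<in>cmultisets A. INF \<beta>\<in>cmultisets A. mset_dist p d (s' + \<alpha>) (t' + \<beta>))"
proof (intro INF_greatest)
  fix \<alpha> \<beta> assume \<alpha>: "\<alpha> \<in> cmultisets A" and \<beta>: "\<beta> \<in> cmultisets A"
  obtain \<alpha>1 \<beta>1 where s: "\<alpha>1 \<in> cmultisets A" "\<beta>1 \<in> cmultisets A" "s + \<alpha>1 = s' + \<beta>1"
    using s by (auto simp: dgm_rel_def)
  obtain \<alpha>2 \<beta>2 where t: "\<alpha>2 \<in> cmultisets A" "\<beta>2 \<in> cmultisets A" "t + \<alpha>2 = t' + \<beta>2"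
    using t by (auto simp: dgm_rel_def)
  let ?c = "\<beta>1 + \<beta>2"
  have c: "?c \<in> cmultisets A"
    using s t by (intro plus_cmultisets)
  have "s + (\<alpha>1 + (\<beta>2 + \<alpha>)) = (s + \<alpha>1) + (\<beta>2 + \<alpha>)"
    by (simp add: ac_simps)
  then have 1: "s + (\<alpha>1 + (\<beta>2 + \<alpha>)) = (s' + \<alpha>) + ?c"
    unfolding s(3) by (simp add: ac_simps)
  have "t + (\<alpha>2 + (\<beta>1 + \<beta>)) = (t + \<alpha>2) + (\<beta>1 + \<beta>)"
    by (simp add: ac_simps)
  then have 2: "t + (\<alpha>2 + (\<beta>1 + \<beta>)) = (t' + \<beta>) + ?c"
    unfolding t(3) by (simp add: ac_simps)
  have mem: "\<alpha>1 + (\<beta>2 + \<alpha>) \<in> cmultisets A" "\<alpha>2 + (\<beta>1 + \<beta>) \<in> cmultisets A"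
    using s t \<alpha> \<beta> by (simp_all add: plus_cmultisets)
  have "(INF \<alpha>\<in>cmultisets A. INF \<beta>\<in>cmultisets A. mset_dist p d (s + \<alpha>) (t + \<beta>))
      \<le> mset_dist p d (s + (\<alpha>1 + (\<beta>2 + \<alpha>))) (t + (\<alpha>2 + (\<beta>1 + \<beta>)))"
    using INF_INF_lower[OF mem, of "\<lambda>\<alpha> \<beta>. mset_dist p d (s + \<alpha>) (t + \<beta>)"] .
  also have "\<dots> \<le> mset_dist p d (s' + \<alpha>) (t' + \<beta>)"
    unfolding 1 2 using c A by (intro mset_dist_add_common) (auto simp: cmultisets_def)
  finally show "(INF \<alpha>\<in>cmultisets A. INF \<beta>\<in>cmultisets A. mset_dist p d (s + \<alpha>) (t + \<beta>))
      \<le> mset_dist p d (s' + \<alpha>) (t' + \<beta>)" .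
qed

lemma dgm_edist_class:
  assumes pair: "metric_pair X d A"
    and s: "s \<in> cmultisets X" and t: "t \<in> cmultisets X"
  shows "dgm_edist p d A (dgm_rel X A `` {s}) (dgm_rel X A `` {t}) =
         (INF \<alpha>\<in>cmultisets A. INF \<beta>\<in>cmultisets A. mset_dist p d (s + \<alpha>) (t + \<beta>))"
proof -
  interpret Metric_space X d
    using pair by (simp add: metric_pair_def)
  have "A \<subseteq> X"
    using pair closedin_subset unfolding metric_pair_def by fastforce
  then have A: "\<And>x. x \<in> A \<Longrightarrow> d x x = 0"
    by auto
  let ?\<sigma> = "dgm_rel X A `` {s}" and ?\<tau> = "dgm_rel X A `` {t}"
  have "(SOME s'. s' \<in> ?\<sigma>) \<in> ?\<sigma>" "(SOME t'. t' \<in> ?\<tau>) \<in> ?\<tau>"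
    using equiv_class_self[OF equiv_dgm_rel s] equiv_class_self[OF equiv_dgm_rel t]
    by (metis someI)+
  then have rel: "(s, SOME s'. s' \<in> ?\<sigma>) \<in> dgm_rel X A" "(t, SOME t'. t' \<in> ?\<tau>) \<in> dgm_rel X A"
    by auto
  have sym: "sym (dgm_rel X A)"
    using equiv_dgm_rel by (rule equivE)
  show ?thesis
    unfolding dgm_edist_def
    by (rule antisym[OF dgm_edist_mono_rep[where d = d, OF A symD[OF sym rel(1)] symD[OF sym rel(2)]]
          dgm_edist_mono_rep[where d = d, OF A rel]])
qed

lemma matching_cost_finite_iff:
  "matching_cost p d s \<phi> < \<infinity> \<longleftrightarrow>
     (if p = \<infinity> then (SUP u\<in>occs s. ennreal (d (fst u) (fst (\<phi> u)))) < \<infinity>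
      else (\<Sum>\<^sub>\<infinity>u\<in>occs s. ennreal (d (fst u) (fst (\<phi> u)) powr real_of_ereal p)) < \<infinity>)"
  by (auto simp: matching_cost_def ennreal_powr_def less_top)

lemma matching_cost_inverse:
  assumes "\<And>x y. d x y = d y x" and \<phi>: "bij_betw \<phi> (occs s) (occs t)"
  shows "matching_cost p d t (inv_into (occs s) \<phi>) = matching_cost p d s \<phi>"
proof -
  let ?\<psi> = "inv_into (occs s) \<phi>"
  have t: "occs t = \<phi> ` occs s"
    using \<phi> by (simp add: bij_betw_def)
  have \<psi>: "?\<psi> (\<phi> u) = u" if "u \<in> occs s" for u
    using that \<phi> by (simp add: bij_betw_def)
  have "(\<Sum>\<^sub>\<infinity>v\<in>occs t. ennreal (d (fst v) (fst (?\<psi> v)) powr r)) =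
        (\<Sum>\<^sub>\<infinity>u\<in>occs s. ennreal (d (fst u) (fst (\<phi> u)) powr r))" for r
    by (subst infsum_reindex_bij_betw[OF \<phi>, symmetric])
       (auto intro!: infsum_cong simp: \<psi> assms(1))
  moreover have "(SUP v\<in>occs t. ennreal (d (fst v) (fst (?\<psi> v)))) =
        (SUP u\<in>occs s. ennreal (d (fst u) (fst (\<phi> u))))"
    unfolding t image_image by (rule SUP_cong) (auto simp: \<psi> assms(1))
  ultimately show ?thesis
    by (simp add: matching_cost_def)
qed

lemma mset_dist_finiteE:
  assumes "mset_dist p d s t < \<infinity>"
  obtains \<phi> where "bij_betw \<phi> (occs s) (occs t)" "matching_cost p d s \<phi> < \<infinity>"
  using assms by (auto simp: mset_dist_def INF_less_iff)

lemma dgm_edist_finite: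
  assumes pair: "metric_pair X d A"
    and \<sigma>: "\<sigma> \<in> dgm_space p X d A" and \<tau>: "\<tau> \<in> dgm_space p X d A"
  shows "dgm_edist p d A \<sigma> \<tau> < \<infinity>"
proof -
  interpret Metric_space X d
    using pair by (simp add: metric_pair_def)
  have *: "\<exists>s \<alpha> \<beta> \<phi>. s \<in> cmultisets X \<and> \<sigma> = dgm_rel X A `` {s} \<and> \<alpha> \<in> cmultisets A \<and>
      \<beta> \<in> cmultisets A \<and> bij_betw \<phi> (occs (s + \<alpha>)) (occs \<beta>) \<and> matching_cost p d (s + \<alpha>) \<phi> < \<infinity>"
    if \<sigma>: "\<sigma> \<in> dgm_space p X d A" for \<sigma>
  proof -
    obtain s where s: "s \<in> cmultisets X" "\<sigma> = dgm_rel X A `` {s}"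
      using \<sigma> by (auto simp: dgm_space_def dgms_def elim: quotientE)
    have "dgm_edist p d A \<sigma> (empty_dgm X A) < \<infinity>"
      using \<sigma> by (simp add: dgm_space_def)
    then have "(INF \<alpha>\<in>cmultisets A. INF \<beta>\<in>cmultisets A. mset_dist p d (s + \<alpha>) (0 + \<beta>)) < \<infinity>"
      unfolding s(2) empty_dgm_def by (simp only: dgm_edist_class[OF pair s(1) zero_cmultisets])
    then obtain \<alpha> \<beta> where "\<alpha> \<in> cmultisets A" "\<beta> \<in> cmultisets A" "mset_dist p d (s + \<alpha>) \<beta> < \<infinity>"
      by (auto simp: INF_less_iff)
    with s show ?thesis
      by (metis mset_dist_finiteE)
  qed
  obtain s \<alpha> \<beta> \<phi> where s: "s \<in> cmultisets X" "\<sigma> = dgm_rel X A `` {s}" "\<alpha> \<in> cmultisets A"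
      "\<beta> \<in> cmultisets A" "bij_betw \<phi> (occs (s + \<alpha>)) (occs \<beta>)" "matching_cost p d (s + \<alpha>) \<phi> < \<infinity>"
    using *[OF \<sigma>] by metis
  obtain t \<alpha>' \<beta>' \<psi> where t: "t \<in> cmultisets X" "\<tau> = dgm_rel X A `` {t}" "\<alpha>' \<in> cmultisets A"
      "\<beta>' \<in> cmultisets A" "bij_betw \<psi> (occs (t + \<alpha>')) (occs \<beta>')" "matching_cost p d (t + \<alpha>') \<psi> < \<infinity>"
    using *[OF \<tau>] by metis
  let ?\<psi>' = "inv_into (occs (t + \<alpha>')) \<psi>"
  have \<psi>': "bij_betw ?\<psi>' (occs \<beta>') (occs (t + \<alpha>'))" "matching_cost p d \<beta>' ?\<psi>' < \<infinity>"
    using t bij_betw_inv_into matching_cost_inverse[OF commute t(5)] by auto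
  obtain \<theta> where \<theta>: "bij_betw \<theta> (occs (s + \<alpha> + \<beta>')) (occs (\<beta> + (t + \<alpha>')))"
    and inf: "\<And>F :: 'a \<Rightarrow> 'a \<Rightarrow> ennreal.
           (\<Sum>\<^sub>\<infinity>u\<in>occs (s + \<alpha> + \<beta>'). F (fst u) (fst (\<theta> u))) =
           (\<Sum>\<^sub>\<infinity>u\<in>occs (s + \<alpha>). F (fst u) (fst (\<phi> u))) + (\<Sum>\<^sub>\<infinity>u\<in>occs \<beta>'. F (fst u) (fst (?\<psi>' u)))"
    and sup: "\<And>F :: 'a \<Rightarrow> 'a \<Rightarrow> ennreal.
           (SUP u\<in>occs (s + \<alpha> + \<beta>'). F (fst u) (fst (\<theta> u))) =
           sup (SUP u\<in>occs (s + \<alpha>). F (fst u) (fst (\<phi> u))) (SUP u\<in>occs \<beta>'. F (fst u) (fst (?\<psi>' u)))"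
    by (rule combine_matchings[OF s(5) \<psi>'(1)]) blast
  have "matching_cost p d (s + \<alpha> + \<beta>') \<theta> < \<infinity>"
    using s(6) \<psi>'(2) unfolding matching_cost_finite_iff
    using inf[of "\<lambda>x y. ennreal (d x y powr real_of_ereal p)"] sup[of "\<lambda>x y. ennreal (d x y)"]
    by (auto simp: sup_max split: if_splits)
  moreover have "mset_dist p d (s + \<alpha> + \<beta>') (\<beta> + (t + \<alpha>')) \<le> matching_cost p d (s + \<alpha> + \<beta>') \<theta>"
    unfolding mset_dist_def using \<theta> by (intro INF_lower) simp
  moreover have "dgm_edist p d A \<sigma> \<tau> \<le> mset_dist p d (s + (\<alpha> + \<beta>')) (t + (\<alpha>' + \<beta>))"
    unfolding s(2) t(2) dgm_edist_class[OF pair s(1) t(1)]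
    using INF_INF_lower[OF plus_cmultisets[OF s(3) t(4)] plus_cmultisets[OF t(3) s(4)],
      of "\<lambda>\<alpha> \<beta>. mset_dist p d (s + \<alpha>) (t + \<beta>)"] .
  moreover have "s + (\<alpha> + \<beta>') = s + \<alpha> + \<beta>'" "t + (\<alpha>' + \<beta>) = \<beta> + (t + \<alpha>')"
    by (simp_all add: ac_simps)
  ultimately show ?thesis
    by simp
qed

end

theory Submission
  imports Defs
begin

text \<open>
  For \<open>p = \<infinity>\<close>, the maps \<open>f i\<close> of a convergence of metric pairs induce maps of
  diagrams by push-forward of multisets. Three observations make this work. First, after moving
  the images of the points of \<open>As i\<close> slightly, \<open>f i\<close> maps \<open>As i\<close> into
  \<open>A\<close> (\<open>metric_pair_approximation_adjust\<close>), so push-forward respects the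
  equivalence of multisets. Secondly, the bottleneck distance is a supremum over matched pairs:
  a matching can be pushed forward, and also lifted, by treating its pairs one at a time, and the
  errors do not add up over the pairs (\<open>dgm_edist_push_le\<close>,
  \<open>dgm_edist_le_push\<close>). Thirdly, for the same reason the ball of radius \<open>R\<close>
  around the empty diagram consists of the diagrams supported in the ball of radius \<open>R\<close>
  around \<open>A\<close> (\<open>cball_empty_dgm_iff\<close>), so the domains and the density condition
  match with unchanged radii.

  For \<open>p < \<infinity>\<close>, the two-point spaces \<open>{x, y}\<close> of diameter
  \<open>1 / Suc i\<close> with the subset \<open>{x}\<close> converge to a point. The diagram consisting of
  \<open>n\<close> copies of \<open>y\<close> has distance \<open>n powr (1 / p) / Suc i\<close> from the empty
  diagram, and \<open>n\<close> can be chosen to put this between \<open>1\<close> and \<open>2\<close>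
  (\<open>exists_copies_of_size_one\<close>). The limit has a single diagram, so these diagrams leave
  no room for maps of small distortion (\<open>dgm_space_discontinuous_finite\<close>).
\<close>


section \<open>Countable multisets presented by families\<close>

definition ecard :: "'a set \<Rightarrow> enat" where
  "ecard S = (if finite S then enat (card S) else \<infinity>)"

text \<open>
  A countable multiset is conveniently presented as a countable family: \<open>g\<close>, indexed by
  \<open>I\<close>, presents the multiset in which \<open>x\<close> occurs as often as \<open>g\<close> takes the
  value \<open>x\<close>. Matchings of two multisets then become two families over one index set.
\<close>

definition mset_of :: "('i \<Rightarrow> 'a) \<Rightarrow> 'i set \<Rightarrow> 'a \<Rightarrow> enat" where
  "mset_of g I x = ecard {i \<in> I. g i = x}"

lemma ecard_bij_betw: "bij_betw b S T \<Longrightarrow> ecard S = ecard T"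
  by (auto simp: ecard_def bij_betw_finite bij_betw_same_card)

lemma ecard_eq_imp_bij:
  assumes "countable S" "countable T" "ecard S = ecard T"
  shows "\<exists>b. bij_betw b S T"
proof (cases "finite S")
  case True
  with assms(3) have "finite T" "card S = card T"
    by (auto simp: ecard_def split: if_splits)
  with True show ?thesis
    by (auto intro: finite_same_card_bij)
next
  case False
  with assms(3) have "infinite T"
    by (auto simp: ecard_def split: if_splits)
  with False assms(1,2) show ?thesis
    by (meson bij_betw_inv bij_betw_trans to_nat_on_infinite)
qed

lemma ecard_Un_disjoint: "S \<inter> T = {} \<Longrightarrow> ecard (S \<union> T) = ecard S + ecard T"
  by (auto simp: ecard_def card_Un_disjoint)

lemma ecard_less_enat: "ecard {k. enat k < m} = m"
  by (cases m) (auto simp: ecard_def)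

lemma mset_of_reindex:
  assumes b: "bij_betw b I J" and h: "\<And>i. i \<in> I \<Longrightarrow> h (b i) = g i"
  shows "mset_of g I = mset_of h J"
proof
  fix x
  have "bij_betw b {i \<in> I. g i = x} {j \<in> J. h j = x}"
    using b h by (fastforce simp: bij_betw_def inj_on_def)
  then show "mset_of g I x = mset_of h J x"
    unfolding mset_of_def by (rule ecard_bij_betw)
qed

text \<open>
  Conversely to \<open>mset_of_reindex\<close>, a presentation is unique up to reindexing: the fibres of
  \<open>g\<close> and \<open>h\<close> over each point have the same size, so bijections between them can be
  glued. This lets any presentation of a multiset be replaced by a more informative one.
\<close>

lemma mset_of_eq_imp_bij:
  assumes "countable I" "countable J" and eq: "mset_of g I = mset_of h J"
  obtains b where "bij_betw b I J" "\<And>i. i \<in> I \<Longrightarrow> h (b i) = g i"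
proof -
  have "\<exists>c. bij_betw c {i \<in> I. g i = x} {j \<in> J. h j = x}" for x
    using assms(1,2) fun_cong[OF eq, of x]
    by (intro ecard_eq_imp_bij) (auto simp: mset_of_def)
  then obtain c where c: "\<And>x. bij_betw (c x) {i \<in> I. g i = x} {j \<in> J. h j = x}"
    by metis
  have cJ: "c (g i) i \<in> J" "h (c (g i) i) = g i" if "i \<in> I" for i
    using bij_betwE[OF c[of "g i"]] that by auto
  have "bij_betw (\<lambda>i. c (g i) i) I J"
  proof (rule bij_betw_imageI)
    show "inj_on (\<lambda>i. c (g i) i) I"
    proof (rule inj_onI)
      fix i j assume ij: "i \<in> I" "j \<in> I" "c (g i) i = c (g j) j"
      then have "g i = g j"
        using cJ(2) by metis
      then show "i = j"
        using ij c[of "g i"] by (auto simp: bij_betw_def inj_on_def)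
    qed
    show "(\<lambda>i. c (g i) i) ` I = J"
    proof
      show "J \<subseteq> (\<lambda>i. c (g i) i) ` I"
      proof
        fix j assume "j \<in> J"
        then have "j \<in> c (h j) ` {i \<in> I. g i = h j}"
          using c[of "h j"] by (auto simp: bij_betw_def)
        then show "j \<in> (\<lambda>i. c (g i) i) ` I"
          by (auto intro: rev_image_eqI)
      qed
    qed (use cJ in auto)
  qed
  with cJ(2) show thesis
    by (intro that)
qed

lemma mset_of_occs: "mset_of fst (occs s) = s"
proof
  fix x
  have "bij_betw (Pair x) {k. enat k < s x} {u \<in> occs s. fst u = x}"
    by (auto simp: occs_def bij_betw_def inj_on_def)
  then show "mset_of fst (occs s) x = s x"
    unfolding mset_of_def by (metis ecard_bij_betw ecard_less_enat)
qed

lemma mset_of_Plus: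
  fixes g :: "'a \<Rightarrow> 'b" and h :: "'c \<Rightarrow> 'b"
  shows "mset_of (case_sum g h) (I <+> J) = mset_of g I + mset_of h J"
proof
  fix x
  let ?L = "Inl ` {i \<in> I. g i = x} :: ('a + 'c) set" and ?R = "Inr ` {j \<in> J. h j = x} :: ('a + 'c) set"
  have "{w \<in> I <+> J. case_sum g h w = x} = ?L \<union> ?R"
    by auto
  then have "mset_of (case_sum g h) (I <+> J) x = ecard (?L \<union> ?R)"
    by (simp add: mset_of_def)
  also have "\<dots> = ecard ?L + ecard ?R"
    by (rule ecard_Un_disjoint) auto
  also have "\<dots> = (mset_of g I + mset_of h J) x"
    by (auto simp: mset_of_def ecard_def finite_image_iff card_image)
  finally show "mset_of (case_sum g h) (I <+> J) x = (mset_of g I + mset_of h J) x" .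
qed

lemma mset_of_nonzero_iff: "mset_of g I x \<noteq> 0 \<longleftrightarrow> x \<in> g ` I"
  by (auto simp: mset_of_def ecard_def zero_enat_def dest: infinite_imp_nonempty)

lemma mset_of_cmultisets_iff:
  assumes "countable I"
  shows "mset_of g I \<in> cmultisets Y \<longleftrightarrow> g ` I \<subseteq> Y"
  using assms by (auto simp: cmultisets_def mset_of_nonzero_iff)

lemma fst_occs: "s \<in> cmultisets Y \<Longrightarrow> u \<in> occs s \<Longrightarrow> fst u \<in> Y"
  by (cases u) (force simp: cmultisets_def occs_def)

lemma countable_occs: "s \<in> cmultisets Y \<Longrightarrow> countable (occs s)"
  by (rule countable_subset[of _ "{x. s x \<noteq> 0} \<times> UNIV"])
    (force simp: cmultisets_def occs_def)+

definition push :: "('a \<Rightarrow> 'b) \<Rightarrow> ('a \<Rightarrow> enat) \<Rightarrow> 'b \<Rightarrow> enat" where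
  "push f s = mset_of (f \<circ> fst) (occs s)"

lemma push_mset_of:
  assumes "countable I"
  shows "push f (mset_of g I) = mset_of (f \<circ> g) I"
proof -
  have "countable (occs (mset_of g I))"
    using assms by (auto intro!: countable_occs[of _ UNIV] simp: mset_of_cmultisets_iff)
  with assms obtain b where "bij_betw b I (occs (mset_of g I))"
      "\<And>i. i \<in> I \<Longrightarrow> fst (b i) = g i"
    using mset_of_eq_imp_bij[OF _ _ mset_of_occs[symmetric]] by metis
  then show ?thesis
    unfolding push_def by (intro mset_of_reindex[symmetric]) auto
qed

lemma push_zero [simp]: "push f 0 = 0"
  by (simp add: push_def occs_def mset_of_def ecard_def fun_eq_iff zero_enat_def)

lemma push_plus:
  assumes "s \<in> cmultisets Y" "t \<in> cmultisets Z"
  shows "push f (s + t) = push f s + push f t"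
proof -
  have "countable (occs s <+> occs t)"
    using assms by (auto intro: countable_occs)
  then have "push f (mset_of (case_sum fst fst) (occs s <+> occs t))
      = mset_of (case_sum (f \<circ> fst) (f \<circ> fst)) (occs s <+> occs t)"
    by (simp add: push_mset_of o_case_sum)
  then show ?thesis
    by (simp add: mset_of_Plus mset_of_occs push_def)
qed

lemma push_cmultisets:
  assumes "s \<in> cmultisets Y" "f ` Y \<subseteq> Z"
  shows "push f s \<in> cmultisets Z"
  unfolding push_def mset_of_cmultisets_iff[OF countable_occs[OF assms(1)]]
  using assms(2) fst_occs[OF assms(1)] by auto

section \<open>Couplings and the bottleneck distance\<close>

text \<open>
  This lemma and the next express the bottleneck distance by couplings: a matching of cost at
  most \<open>c\<close> amounts to presenting both multisets by families over the same index set whose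
  corresponding members are at distance at most \<open>c\<close>. The index set is arbitrary when a
  coupling is given, and may be taken to be the set of occurrences when one is extracted.
\<close>

lemma mset_dist_infty_le:
  fixes g h :: "'a \<Rightarrow> 'c"
  assumes I: "countable I" and c: "\<And>i. i \<in> I \<Longrightarrow> d (g i) (h i) \<le> c"
  shows "mset_dist \<infinity> d (mset_of g I) (mset_of h I) \<le> ennreal c"
proof -
  have occs: "countable (occs (mset_of k I))" for k :: "'a \<Rightarrow> 'c"
    using I by (auto intro!: countable_occs[of _ UNIV] simp: mset_of_cmultisets_iff)
  obtain b1 where b1: "bij_betw b1 I (occs (mset_of g I))" "\<And>i. i \<in> I \<Longrightarrow> fst (b1 i) = g i"
    using mset_of_eq_imp_bij[OF I occs mset_of_occs[symmetric]] by metis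
  obtain b2 where b2: "bij_betw b2 I (occs (mset_of h I))" "\<And>i. i \<in> I \<Longrightarrow> fst (b2 i) = h i"
    using mset_of_eq_imp_bij[OF I occs mset_of_occs[symmetric]] by metis
  define \<phi> where "\<phi> = b2 \<circ> inv_into I b1"
  have \<phi>: "bij_betw \<phi> (occs (mset_of g I)) (occs (mset_of h I))"
    unfolding \<phi>_def by (rule bij_betw_trans[OF bij_betw_inv_into[OF b1(1)] b2(1)])
  have "matching_cost \<infinity> d (mset_of g I) \<phi> \<le> ennreal c"
    unfolding matching_cost_def
  proof (simp, rule SUP_least)
    fix u assume "u \<in> occs (mset_of g I)"
    then obtain i where i: "i \<in> I" "u = b1 i"
      using b1(1) by (auto simp: bij_betw_def)
    then have "\<phi> u = b2 i"
      using b1(1) by (simp add: \<phi>_def bij_betw_def)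
    with i show "ennreal (d (fst u) (fst (\<phi> u))) \<le> ennreal c"
      using b1(2) b2(2) c by (auto intro: ennreal_leI)
  qed
  moreover have "mset_dist \<infinity> d (mset_of g I) (mset_of h I) \<le> matching_cost \<infinity> d (mset_of g I) \<phi>"
    unfolding mset_dist_def using \<phi> by (intro INF_lower) simp
  ultimately show ?thesis
    by (rule order_trans[rotated])
qed

lemma mset_dist_infty_lessE:
  assumes "mset_dist \<infinity> d s t < ennreal c" and s: "(s :: 'c \<Rightarrow> enat) \<in> cmultisets X"
  obtains I :: "('c \<times> nat) set" and g h where "countable I" "mset_of g I = s" "mset_of h I = t"
    "\<And>i. i \<in> I \<Longrightarrow> d (g i) (h i) \<le> c"
proof -
  obtain \<phi> where \<phi>: "bij_betw \<phi> (occs s) (occs t)" "matching_cost \<infinity> d s \<phi> < ennreal c"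
    using assms(1) by (auto simp: mset_dist_def INF_less_iff)
  have "d (fst u) ((fst \<circ> \<phi>) u) \<le> c" if "u \<in> occs s" for u
  proof -
    have "ennreal (d (fst u) (fst (\<phi> u))) \<le> matching_cost \<infinity> d s \<phi>"
      unfolding matching_cost_def using that by (auto intro: SUP_upper)
    then have "ennreal (d (fst u) (fst (\<phi> u))) < ennreal c"
      using \<phi>(2) by (rule le_less_trans)
    then show ?thesis
      by (cases "d (fst u) (fst (\<phi> u)) \<ge> 0") 
        (auto simp: ennreal_less_iff ennreal_neg)
  qed
  moreover have "mset_of (fst \<circ> \<phi>) (occs s) = t"
    using mset_of_reindex[OF \<phi>(1), of fst "fst \<circ> \<phi>"] by (simp add: mset_of_occs)
  ultimately show thesis
    using countable_occs[OF s] mset_of_occs[of s] by (intro that[of "occs s" fst "fst \<circ> \<phi>"])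
qed

lemma metric_pair_subset: "metric_pair X d A \<Longrightarrow> A \<subseteq> X"
  unfolding metric_pair_def by (metis Metric_space.topspace_mtopology closedin_subset)

lemma dgm_edist_infty_lessE:
  assumes pair: "metric_pair X d A"
    and s: "(s :: 'a \<Rightarrow> enat) \<in> cmultisets X" and t: "t \<in> cmultisets X"
    and less: "dgm_edist \<infinity> d A (dgm_rel X A `` {s}) (dgm_rel X A `` {t}) < ennreal c"
  obtains I :: "('a \<times> nat) set" and g h \<alpha> \<beta>
  where "countable I" "\<alpha> \<in> cmultisets A" "\<beta> \<in> cmultisets A"
    "mset_of g I = s + \<alpha>" "mset_of h I = t + \<beta>" "\<And>i. i \<in> I \<Longrightarrow> d (g i) (h i) \<le> c"
proof -
  from less obtain \<alpha> \<beta> where \<alpha>: "\<alpha> \<in> cmultisets A" and \<beta>: "\<beta> \<in> cmultisets A"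
    and 1: "mset_dist \<infinity> d (s + \<alpha>) (t + \<beta>) < ennreal c"
    unfolding dgm_edist_class[OF pair s t] by (auto simp: INF_less_iff)
  have "s + \<alpha> \<in> cmultisets X"
    using s \<alpha> cmultisets_mono[OF metric_pair_subset[OF pair]] by (auto intro: plus_cmultisets)
  from mset_dist_infty_lessE[OF 1 this] that[OF _ \<alpha> \<beta>] show thesis
    by metis
qed

lemma dgm_edist_infty_le:
  assumes pair: "metric_pair X d A"
    and s: "s \<in> cmultisets X" and t: "t \<in> cmultisets X"
    and \<alpha>: "\<alpha> \<in> cmultisets A" and \<beta>: "\<beta> \<in> cmultisets A"
    and I: "countable I" "mset_of g I = s + \<alpha>" "mset_of h I = t + \<beta>"
    and c: "\<And>i. i \<in> I \<Longrightarrow> d (g i) (h i) \<le> c"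
  shows "dgm_edist \<infinity> d A (dgm_rel X A `` {s}) (dgm_rel X A `` {t}) \<le> ennreal c"
proof -
  have "dgm_edist \<infinity> d A (dgm_rel X A `` {s}) (dgm_rel X A `` {t})
      \<le> mset_dist \<infinity> d (mset_of g I) (mset_of h I)"
    unfolding dgm_edist_class[OF pair s t] I using \<alpha> \<beta> by (rule INF_INF_lower)
  also have "\<dots> \<le> ennreal c"
    using I(1) c by (rule mset_dist_infty_le)
  finally show ?thesis .
qed

lemma ennreal_le_add_epsilon:
  fixes x :: ennreal
  assumes "0 \<le> r" and "\<And>e. 0 < e \<Longrightarrow> x \<le> ennreal (r + e)"
  shows "x \<le> ennreal r"
proof (rule ennreal_le_epsilon)
  fix e :: real assume "0 < e"
  with assms(2)[of e] show "x \<le> ennreal r + ennreal e"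
    using ennreal_plus[OF assms(1), of e] by simp
qed

text \<open>
  The infima that define the distances need not be attained, so that estimates are made for
  every \<open>c\<close> above the infimum; this turns them into an inequality between the infima.
\<close>

lemma ennreal_le_shift:
  fixes x y :: ennreal
  assumes "0 \<le> r" and "\<And>c. 0 \<le> c \<Longrightarrow> x < ennreal c \<Longrightarrow> y \<le> ennreal (c + r)"
  shows "y \<le> x + ennreal r"
proof (cases x)
  case (real a)
  have "y \<le> ennreal ((a + r) + e)" if "0 < e" for e

  proof -
    have "y \<le> ennreal ((a + e) + r)"
      using real that by (intro assms(2)) (auto simp: ennreal_less_iff)
    also have "(a + e) + r = (a + r) + e"
      by simp
    finally show ?thesis .
  qed
  then have "y \<le> ennreal (a + r)"
    by (rule ennreal_le_add_epsilon[OF add_nonneg_nonneg[OF real(1) assms(1)]])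
  then show ?thesis
    using real ennreal_plus[OF real(1) assms(1)] by (simp only:)
qed auto

lemma dist_to_set_leI: "s \<in> S \<Longrightarrow> d x s \<le> r \<Longrightarrow> dist_to_set d x S \<le> ennreal r"
  unfolding dist_to_set_def by (meson INF_lower2 ennreal_leI)

lemma dist_to_set_nearE:
  assumes "dist_to_set d x S \<le> ennreal r" "0 \<le> r" "r < r'"
  obtains s where "s \<in> S" "d x s < r'"
proof -
  have "dist_to_set d x S < ennreal r'"
    using assms by (intro le_less_trans[OF assms(1)] ennreal_lessI) auto
  then obtain s where "s \<in> S" "ennreal (d x s) < ennreal r'"
    by (auto simp: dist_to_set_def INF_less_iff)
  with assms show thesis
    by (intro that[of s]) (cases "d x s \<ge> 0"; simp add: ennreal_less_iff)+
qed

lemma subset_cball_set: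
  assumes "metric_pair X d A" "0 \<le> r"
  shows "A \<subseteq> cball_set X d r A"
proof
  interpret Metric_space X d
    using assms(1) by (simp add: metric_pair_def)
  fix a assume a: "a \<in> A"
  then have "a \<in> X" using metric_pair_subset[OF assms(1)] by auto
  with a assms(2) show "a \<in> cball_set X d r A"
    by (auto simp: cball_set_def intro!: dist_to_set_leI[of a])
qed

section \<open>Balls around the empty diagram\<close>

text \<open>
  Matching \<open>s\<close> with a multiset in \<open>A\<close> at cost about \<open>R\<close> only asks of
  each point of \<open>s\<close>, separately, that it be within about \<open>R\<close> of \<open>A\<close>,
  however many points there are. For \<open>p < \<infinity>\<close> many points close to
  \<open>A\<close> add up to a large distance, which is where continuity is lost.
\<close>

lemma dgm_edist_empty_le_iff:
  assumes pair: "metric_pair X d A" and s: "(s :: 'a \<Rightarrow> enat) \<in> cmultisets X" and R: "0 \<le> R"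
  shows "dgm_edist \<infinity> d A (dgm_rel X A `` {s}) (empty_dgm X A) \<le> ennreal R
    \<longleftrightarrow> s \<in> cmultisets (cball_set X d R A)"
proof
  assume le: "dgm_edist \<infinity> d A (dgm_rel X A `` {s}) (empty_dgm X A) \<le> ennreal R"
  have "x \<in> cball_set X d R A" if x: "s x \<noteq> 0" for x
  proof -
    have "dist_to_set d x A \<le> ennreal (R + e)" if "0 < e" for e
    proof -
      have "dgm_edist \<infinity> d A (dgm_rel X A `` {s}) (dgm_rel X A `` {0}) < ennreal (R + e)"
        using R that by (intro le_less_trans[OF le[unfolded empty_dgm_def]] ennreal_lessI) auto
      from dgm_edist_infty_lessE[OF pair s zero_cmultisets this]
      obtain I :: "('a \<times> nat) set" and g h \<alpha> \<beta> where
        I: "countable I" "\<beta> \<in> cmultisets A" "mset_of g I = s + \<alpha>" "mset_of h I = 0 + \<beta>"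
          "\<And>i. i \<in> I \<Longrightarrow> d (g i) (h i) \<le> R + e"
        by metis
      have "mset_of g I x \<noteq> 0"
        using x I(3) by simp
      then obtain i where i: "i \<in> I" "g i = x"
        by (auto simp: mset_of_nonzero_iff)
      have "h i \<in> A"
        using I(2,4) i mset_of_cmultisets_iff[OF I(1), of h A] by auto
      then show ?thesis
        using I(5)[OF i(1)] i(2) by (intro dist_to_set_leI) auto
    qed
    then have "dist_to_set d x A \<le> ennreal R"
      by (rule ennreal_le_add_epsilon[OF R])
    then show ?thesis
      using x s by (auto simp: cball_set_def cmultisets_def)
  qed
  then show "s \<in> cmultisets (cball_set X d R A)"
    using s by (auto simp: cmultisets_def)
next
  assume sN: "s \<in> cmultisets (cball_set X d R A)"
  have "dgm_edist \<infinity> d A (dgm_rel X A `` {s}) (dgm_rel X A `` {0}) \<le> ennreal (R + e)"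
    if "0 < e" for e
  proof -
    have "\<exists>a\<in>A. d x a \<le> R + e" if "x \<in> cball_set X d R A" for x
    proof -
      have "dist_to_set d x A \<le> ennreal R"
        using that by (simp add: cball_set_def)
      from dist_to_set_nearE[OF this R, of "R + e"] \<open>0 < e\<close> show ?thesis
        by (metis less_add_same_cancel1 less_imp_le)
    qed
    then obtain a where a: "\<And>x. x \<in> cball_set X d R A \<Longrightarrow> a x \<in> A \<and> d x (a x) \<le> R + e"
      by metis
    show ?thesis
    proof (rule dgm_edist_infty_le[OF pair s zero_cmultisets zero_cmultisets])
      show "push a s \<in> cmultisets A"
        using sN a by (intro push_cmultisets) auto
      show "countable (occs s)"
        using s by (rule countable_occs)
      show "mset_of fst (occs s) = s + 0" "mset_of (a \<circ> fst) (occs s) = 0 + push a s"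
        by (simp_all add: mset_of_occs push_def)
      show "d (fst u) ((a \<circ> fst) u) \<le> R + e" if "u \<in> occs s" for u
        using a fst_occs[OF sN that] by simp
    qed
  qed
  then show "dgm_edist \<infinity> d A (dgm_rel X A `` {s}) (empty_dgm X A) \<le> ennreal R"
    unfolding empty_dgm_def by (rule ennreal_le_add_epsilon[OF R])
qed

text \<open>
  Balls around the empty diagram have the same radius as the balls around \<open>A\<close> that they
  come from. Hence the radii of an approximation of metric pairs also serve for the spaces of
  diagrams.
\<close>

lemma cball_empty_dgm_iff:
  assumes pair: "metric_pair X d A" and R: "0 \<le> R"
  shows "\<sigma> \<in> cball_set (dgm_space \<infinity> X d A) (dgm_dist \<infinity> d A) R {empty_dgm X A}
    \<longleftrightarrow> (\<exists>s \<in> cmultisets (cball_set X d R A). \<sigma> = dgm_rel X A `` {s})"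
    (is "?l \<longleftrightarrow> ?r")
proof -
  have NX: "cball_set X d R A \<subseteq> X"
    by (auto simp: cball_set_def)
  let ?D = "dgm_edist \<infinity> d A"
  have "?D \<sigma> (empty_dgm X A) < \<infinity>" if "?D \<sigma> (empty_dgm X A) \<le> ennreal R"
    by (rule le_less_trans[OF that]) simp
  then have "?l \<longleftrightarrow> \<sigma> \<in> dgms X A \<and> ?D \<sigma> (empty_dgm X A) \<le> ennreal R"
    by (auto simp: cball_set_def dgm_space_def dist_to_set_def dgm_dist_def)
  also have "\<dots> \<longleftrightarrow> (\<exists>s\<in>cmultisets X. \<sigma> = dgm_rel X A `` {s} \<and> ?D \<sigma> (empty_dgm X A) \<le> ennreal R)"
    by (auto simp: dgms_def quotient_def)
  also have "\<dots> \<longleftrightarrow> ?r"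
    using dgm_edist_empty_le_iff[OF pair _ R] cmultisets_mono[OF NX] by blast
  finally show ?thesis .
qed

section \<open>Push-forward of diagrams along an approximation\<close>

text \<open>
  One map of a Gromov--Hausdorff convergence, with two changes: it takes \<open>B\<close> into
  \<open>A\<close> exactly, as is needed for the induced map to be well defined on classes modulo
  multisets in \<open>B\<close>, and closeness is expressed by points instead of infima.
\<close>

locale metric_pair_approximation =
  fixes Y :: "'a set" and dY B and X :: "'b set" and dX A and R \<delta> :: real and f
  assumes pairY: "metric_pair Y dY B" and pairX: "metric_pair X dX A"
    and R: "0 \<le> R" and \<delta>: "0 \<le> \<delta>"
    and f_X: "f ` cball_set Y dY R B \<subseteq> X" and f_A: "f ` B \<subseteq> A"
    and distortion: "\<And>x y. x \<in> cball_set Y dY R B \<Longrightarrow> y \<in> cball_set Y dY R B \<Longrightarrow>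
          \<bar>dY x y - dX (f x) (f y)\<bar> \<le> \<delta>"
    and dense_A: "\<And>a. a \<in> A \<Longrightarrow> \<exists>b\<in>B. dX a (f b) \<le> \<delta>"
    and dense_ball: "\<And>y. y \<in> cball_set X dX R A \<Longrightarrow> \<exists>x\<in>cball_set Y dY R B. dX y (f x) \<le> \<delta>"
begin

sublocale Y: Metric_space Y dY
  using pairY by (simp add: metric_pair_def)

sublocale X: Metric_space X dX
  using pairX by (simp add: metric_pair_def)

abbreviation N where "N \<equiv> cball_set Y dY R B"

lemma N_Y: "N \<subseteq> Y"
  by (auto simp: cball_set_def)

lemma B_N: "B \<subseteq> N"
  using pairY R by (rule subset_cball_set)

text \<open>
  The push-forward is meant for diagrams supported in \<open>N\<close>, outside of which nothing is
  known about \<open>f\<close>; on these the choice of representative does not matter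
  (\<open>push_dgm_class\<close> below).
\<close>

definition push_dgm :: "('a \<Rightarrow> enat) set \<Rightarrow> ('b \<Rightarrow> enat) set" where
  "push_dgm \<sigma> = dgm_rel X A `` {push f (SOME s. s \<in> \<sigma>)}"

lemma push_X: "s \<in> cmultisets N \<Longrightarrow> push f s \<in> cmultisets X"
  using push_cmultisets f_X by blast

lemma push_dgm_class:
  assumes s: "s \<in> cmultisets N"
  shows "push_dgm (dgm_rel Y B `` {s}) = dgm_rel X A `` {push f s}"
proof -
  define t where "t = (SOME t. t \<in> dgm_rel Y B `` {s})"
  have "s \<in> cmultisets Y"
    using s cmultisets_mono[OF N_Y] by auto
  then have "t \<in> dgm_rel Y B `` {s}"
    using equiv_class_self[OF equiv_dgm_rel] unfolding t_def by (metis someI)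
  then obtain \<alpha> \<beta> where \<alpha>: "\<alpha> \<in> cmultisets B" and \<beta>: "\<beta> \<in> cmultisets B"
    and t: "t \<in> cmultisets Y" and st: "s + \<alpha> = t + \<beta>"
    by (auto simp: dgm_rel_def)
  \<comment> \<open>Representatives differ only by points of \<open>B\<close>, so the other one is also supported in
    \<open>N\<close>.\<close>
  have "s + \<alpha> \<in> cmultisets N"
    using s \<alpha> cmultisets_mono[OF B_N] by (auto intro: plus_cmultisets)
  then have tN: "t \<in> cmultisets N"
    using t unfolding st by (auto simp: cmultisets_def)
  have "push f s + push f \<alpha> = push f t + push f \<beta>"
    using push_plus[OF s \<alpha>, of f] push_plus[OF tN \<beta>, of f] st by simp
  moreover have "push f \<alpha> \<in> cmultisets A" "push f \<beta> \<in> cmultisets A"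
    using \<alpha> \<beta> f_A by (auto intro: push_cmultisets)
  ultimately have "(push f s, push f t) \<in> dgm_rel X A"
    using push_X[OF s] push_X[OF tN] unfolding dgm_rel_def by blast
  then show ?thesis
    unfolding push_dgm_def t_def[symmetric] by (rule equiv_class_eq[OF equiv_dgm_rel, symmetric])
qed

lemma push_empty_dgm: "push_dgm (empty_dgm Y B) = empty_dgm X A"
  unfolding empty_dgm_def by (simp add: push_dgm_class)

text \<open>
  A coupling of \<open>s\<close> and \<open>t\<close>, with points of \<open>B\<close> added, is composed
  with \<open>f\<close>; the added points end up in \<open>A\<close>.
\<close>

lemma dgm_edist_push_le:
  assumes s: "s \<in> cmultisets N" and t: "t \<in> cmultisets N"
  shows "dgm_edist \<infinity> dX A (dgm_rel X A `` {push f s}) (dgm_rel X A `` {push f t})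
    \<le> dgm_edist \<infinity> dY B (dgm_rel Y B `` {s}) (dgm_rel Y B `` {t}) + ennreal \<delta>"
proof (rule ennreal_le_shift[OF \<delta>])
  fix c
  assume less: "dgm_edist \<infinity> dY B (dgm_rel Y B `` {s}) (dgm_rel Y B `` {t}) < ennreal c"
  have stY: "s \<in> cmultisets Y" "t \<in> cmultisets Y"
    using s t cmultisets_mono[OF N_Y] by auto
  from dgm_edist_infty_lessE[OF pairY stY less]
  obtain I :: "('a \<times> nat) set" and g h \<alpha> \<beta> where I: "countable I"
    and \<alpha>: "\<alpha> \<in> cmultisets B" and \<beta>: "\<beta> \<in> cmultisets B"
    and g: "mset_of g I = s + \<alpha>" and h: "mset_of h I = t + \<beta>"
    and c: "\<And>i. i \<in> I \<Longrightarrow> dY (g i) (h i) \<le> c"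
    by metis
  have "mset_of g I \<in> cmultisets N" "mset_of h I \<in> cmultisets N"
    unfolding g h using s t \<alpha> \<beta> cmultisets_mono[OF B_N] by (auto intro: plus_cmultisets)
  then have N: "g i \<in> N" "h i \<in> N" if "i \<in> I" for i
    using that by (auto simp: mset_of_cmultisets_iff[OF I])
  show "dgm_edist \<infinity> dX A (dgm_rel X A `` {push f s}) (dgm_rel X A `` {push f t}) \<le> ennreal (c + \<delta>)"
  proof (rule dgm_edist_infty_le[OF pairX push_X[OF s] push_X[OF t]])
    show "push f \<alpha> \<in> cmultisets A" "push f \<beta> \<in> cmultisets A"
      using \<alpha> \<beta> f_A by (auto intro: push_cmultisets)
    show "mset_of (f \<circ> g) I = push f s + push f \<alpha>" "mset_of (f \<circ> h) I = push f t + push f \<beta>"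
      using push_mset_of[OF I, of f g] push_mset_of[OF I, of f h]
      unfolding g h push_plus[OF s \<alpha>] push_plus[OF t \<beta>] by simp_all
    show "dX ((f \<circ> g) i) ((f \<circ> h) i) \<le> c + \<delta>" if "i \<in> I" for i
      using distortion[OF N[OF that]] c[OF that] by simp
  qed (rule I)
qed

text \<open>
  Couplings can also be lifted along \<open>f\<close>: a member of \<open>g\<close> that comes from
  \<open>push f s\<close> is lifted to the point of \<open>s\<close> that it is the image of, and one that
  comes from \<open>\<alpha>\<close> to a point of \<open>B\<close> whose image is close. To tell the two
  kinds apart, \<open>I\<close> is reindexed by the disjoint union of the occurrences in \<open>s\<close>
  and in \<open>\<alpha>\<close>.
\<close>

lemma lift_family:
  assumes s: "s \<in> cmultisets N" and \<alpha>: "\<alpha> \<in> cmultisets A"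
    and I: "countable I" and g: "mset_of g I = push f s + \<alpha>"
  obtains g' \<alpha>' where "\<alpha>' \<in> cmultisets B" "mset_of g' I = s + \<alpha>'"
    "\<And>i. i \<in> I \<Longrightarrow> g' i \<in> N \<and> dX (g i) (f (g' i)) \<le> \<delta>"
proof -
  obtain r where r: "\<And>a. a \<in> A \<Longrightarrow> r a \<in> B \<and> dX a (f (r a)) \<le> \<delta>"
    using dense_A by metis
  let ?J = "occs s <+> occs \<alpha>"
  have J: "countable ?J"
    using s \<alpha> by (auto intro: countable_occs)
  have "mset_of g I = mset_of (case_sum (f \<circ> fst) fst) ?J"
    by (simp add: g mset_of_Plus mset_of_occs push_def)
  then obtain b where b: "bij_betw b I ?J" "\<And>i. i \<in> I \<Longrightarrow> case_sum (f \<circ> fst) fst (b i) = g i"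
    by (rule mset_of_eq_imp_bij[OF I J]) metis
  define g' where "g' = case_sum fst (r \<circ> fst) \<circ> b"
  show thesis
  proof (rule that)
    show "push r \<alpha> \<in> cmultisets B"
      using \<alpha> r by (intro push_cmultisets) auto
    have "mset_of g' I = mset_of (case_sum fst (r \<circ> fst)) ?J"
      by (rule mset_of_reindex[OF b(1)]) (simp add: g'_def)
    then show "mset_of g' I = s + push r \<alpha>"
      by (simp add: mset_of_Plus mset_of_occs push_def)
    show "g' i \<in> N \<and> dX (g i) (f (g' i)) \<le> \<delta>" if i: "i \<in> I" for i
    proof (cases "b i")
      case (Inl u)
      then have "fst u \<in> N"
        using bij_betwE[OF b(1)] i fst_occs[OF s] by fastforce
      then show ?thesis
        using b(2)[OF i] f_X Inl \<delta> by (auto simp: g'_def)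
    next
      case (Inr u)
      then have "fst u \<in> A"
        using bij_betwE[OF b(1)] i fst_occs[OF \<alpha>] by fastforce
      then show ?thesis
        using b(2)[OF i] r B_N Inr by (auto simp: g'_def)
    qed
  qed
qed

text \<open>
  Lifting both families of a coupling moves each end of a pair by at most \<open>\<delta>\<close>,
  and the distortion of \<open>f\<close> contributes a third \<open>\<delta>\<close>.
\<close>

lemma dgm_edist_le_push:
  assumes s: "s \<in> cmultisets N" and t: "t \<in> cmultisets N"
  shows "dgm_edist \<infinity> dY B (dgm_rel Y B `` {s}) (dgm_rel Y B `` {t})
    \<le> dgm_edist \<infinity> dX A (dgm_rel X A `` {push f s}) (dgm_rel X A `` {push f t}) + ennreal (3 * \<delta>)"
proof (rule ennreal_le_shift)
  fix c
  assume less: "dgm_edist \<infinity> dX A (dgm_rel X A `` {push f s}) (dgm_rel X A `` {push f t}) < ennreal c"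
  from dgm_edist_infty_lessE[OF pairX push_X[OF s] push_X[OF t] less]
  obtain I :: "('b \<times> nat) set" and g h \<alpha> \<beta> where I: "countable I"
    and \<alpha>: "\<alpha> \<in> cmultisets A" and \<beta>: "\<beta> \<in> cmultisets A"
    and g: "mset_of g I = push f s + \<alpha>" and h: "mset_of h I = push f t + \<beta>"
    and c: "\<And>i. i \<in> I \<Longrightarrow> dX (g i) (h i) \<le> c"
    by metis
  obtain g' \<alpha>' where \<alpha>': "\<alpha>' \<in> cmultisets B" and g': "mset_of g' I = s + \<alpha>'"
    and g'N: "\<And>i. i \<in> I \<Longrightarrow> g' i \<in> N" and gg': "\<And>i. i \<in> I \<Longrightarrow> dX (g i) (f (g' i)) \<le> \<delta>"
    using lift_family[OF s \<alpha> I g] by metis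
  obtain h' \<beta>' where \<beta>': "\<beta>' \<in> cmultisets B" and h': "mset_of h' I = t + \<beta>'"
    and h'N: "\<And>i. i \<in> I \<Longrightarrow> h' i \<in> N" and hh': "\<And>i. i \<in> I \<Longrightarrow> dX (h i) (f (h' i)) \<le> \<delta>"
    using lift_family[OF t \<beta> I h] by metis
  have "mset_of g I \<in> cmultisets X" "mset_of h I \<in> cmultisets X"
    unfolding g h using push_X[OF s] push_X[OF t] \<alpha> \<beta> cmultisets_mono[OF metric_pair_subset[OF pairX]]
    by (auto intro: plus_cmultisets)
  then have X: "g i \<in> X" "h i \<in> X" if "i \<in> I" for i
    using that by (auto simp: mset_of_cmultisets_iff[OF I])
  have stY: "s \<in> cmultisets Y" "t \<in> cmultisets Y"
    using s t cmultisets_mono[OF N_Y] by auto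
  show "dgm_edist \<infinity> dY B (dgm_rel Y B `` {s}) (dgm_rel Y B `` {t}) \<le> ennreal (c + 3 * \<delta>)"
  proof (rule dgm_edist_infty_le[OF pairY stY \<alpha>' \<beta>' I g' h'])
    fix i assume i: "i \<in> I"
    have fX: "f (g' i) \<in> X" "f (h' i) \<in> X"
      using f_X g'N[OF i] h'N[OF i] by auto
    have "dX (f (g' i)) (f (h' i)) \<le> dX (f (g' i)) (g i) + dX (g i) (h i) + dX (h i) (f (h' i))"
      using X.triangle[OF fX(1) X(1)[OF i] X(2)[OF i]] X.triangle[OF fX(1) X(2)[OF i] fX(2)] by simp
    then show "dY (g' i) (h' i) \<le> c + 3 * \<delta>"
      using distortion[OF g'N[OF i] h'N[OF i]] gg'[OF i] hh'[OF i] c[OF i]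
        X.commute[of "g i" "f (g' i)"] by linarith
  qed
qed (use \<delta> in simp)

text \<open>
  Every point of \<open>t\<close> is replaced by a point of \<open>N\<close> whose image is close to it.
  As \<open>N\<close> has the same radius as the ball around \<open>A\<close>, no radius is lost here.
\<close>

lemma dgm_dense_ball:
  assumes t: "t \<in> cmultisets (cball_set X dX R A)"
  obtains s where "s \<in> cmultisets N"
    "dgm_edist \<infinity> dX A (dgm_rel X A `` {t}) (dgm_rel X A `` {push f s}) \<le> ennreal \<delta>"
proof -
  obtain r where r: "\<And>y. y \<in> cball_set X dX R A \<Longrightarrow> r y \<in> N \<and> dX y (f (r y)) \<le> \<delta>"
    using dense_ball by metis
  have tX: "t \<in> cmultisets X"
    using t by (auto simp: cmultisets_def cball_set_def)
  note I = countable_occs[OF t]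
  show thesis
  proof (rule that)
    show s: "push r t \<in> cmultisets N"
      using t r by (intro push_cmultisets) auto
    show "dgm_edist \<infinity> dX A (dgm_rel X A `` {t}) (dgm_rel X A `` {push f (push r t)}) \<le> ennreal \<delta>"
    proof (rule dgm_edist_infty_le[OF pairX tX push_X[OF s] zero_cmultisets zero_cmultisets I])
      show "mset_of fst (occs t) = t + 0"
        by (simp add: mset_of_occs)
      show "mset_of (f \<circ> (r \<circ> fst)) (occs t) = push f (push r t) + 0"
        by (simp add: push_mset_of[OF I] push_def[of r])
      show "dX (fst u) ((f \<circ> (r \<circ> fst)) u) \<le> \<delta>" if "u \<in> occs t" for u
        using r fst_occs[OF t that] by simp
    qed
  qed
qed

text \<open>
  These are the conditions of pointed Gromov--Hausdorff convergence, for the spaces of diagrams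
  and a single index. The error \<open>3 * \<delta>\<close> comes from the lower bound on the
  distances of images, the loosest of the estimates above.
\<close>

lemma push_dgm_approximation:
  defines "DY \<equiv> cball_set (dgm_space \<infinity> Y dY B) (dgm_dist \<infinity> dY B) R {empty_dgm Y B}"
  shows "push_dgm ` DY \<subseteq> dgm_space \<infinity> X dX A"
    and "\<And>\<sigma> \<tau>. \<sigma> \<in> DY \<Longrightarrow> \<tau> \<in> DY \<Longrightarrow>
      \<bar>dgm_dist \<infinity> dY B \<sigma> \<tau> - dgm_dist \<infinity> dX A (push_dgm \<sigma>) (push_dgm \<tau>)\<bar> \<le> 3 * \<delta>"
    and "hausdorff_dist (dgm_dist \<infinity> dX A) (push_dgm ` {empty_dgm Y B}) {empty_dgm X A} \<le> ennreal (3 * \<delta>)"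
    and "cball_set (dgm_space \<infinity> X dX A) (dgm_dist \<infinity> dX A) R {empty_dgm X A}
      \<subseteq> cball_set (dgm_space \<infinity> X dX A) (dgm_dist \<infinity> dX A) (3 * \<delta>) (push_dgm ` DY)"
proof -
  have DY: "\<sigma> \<in> DY \<longleftrightarrow> (\<exists>s\<in>cmultisets N. \<sigma> = dgm_rel Y B `` {s})" for \<sigma>
    unfolding DY_def using pairY R by (rule cball_empty_dgm_iff)
  have DY_space: "\<sigma> \<in> dgm_space \<infinity> Y dY B" if "\<sigma> \<in> DY" for \<sigma>
    using that by (simp add: DY_def cball_set_def)
  have zero_DY: "empty_dgm Y B \<in> DY"
    unfolding DY empty_dgm_def using zero_cmultisets by blast
  have edist: "dgm_edist \<infinity> dX A (push_dgm \<sigma>) (push_dgm \<tau>) \<le> dgm_edist \<infinity> dY B \<sigma> \<tau> + ennreal \<delta>"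
      "dgm_edist \<infinity> dY B \<sigma> \<tau> \<le> dgm_edist \<infinity> dX A (push_dgm \<sigma>) (push_dgm \<tau>) + ennreal (3 * \<delta>)"
    if "\<sigma> \<in> DY" "\<tau> \<in> DY" for \<sigma> \<tau>
    using that dgm_edist_push_le dgm_edist_le_push by (auto simp: DY push_dgm_class)
  have fin: "dgm_edist \<infinity> dY B \<sigma> \<tau> < \<infinity>" if "\<sigma> \<in> DY" "\<tau> \<in> DY" for \<sigma> \<tau>
    using dgm_edist_finite[OF pairY DY_space DY_space] that by blast
  have finX: "dgm_edist \<infinity> dX A (push_dgm \<sigma>) (push_dgm \<tau>) < \<infinity>" if "\<sigma> \<in> DY" "\<tau> \<in> DY" for \<sigma> \<tau>
    by (rule le_less_trans[OF edist(1)[OF that]]) (use fin[OF that] in \<open>simp add: less_top[symmetric]\<close>)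
  show space: "push_dgm ` DY \<subseteq> dgm_space \<infinity> X dX A"
  proof
    fix \<rho> assume "\<rho> \<in> push_dgm ` DY"
    then obtain \<sigma> where \<sigma>: "\<sigma> \<in> DY" "\<rho> = push_dgm \<sigma>"
      by auto
    then have "\<rho> \<in> dgms X A"
      unfolding DY dgms_def using push_dgm_class quotientI[OF push_X] by metis
    with finX[OF \<sigma>(1) zero_DY] \<sigma>(2) show "\<rho> \<in> dgm_space \<infinity> X dX A"
      by (simp add: dgm_space_def push_empty_dgm)
  qed
  show "\<bar>dgm_dist \<infinity> dY B \<sigma> \<tau> - dgm_dist \<infinity> dX A (push_dgm \<sigma>) (push_dgm \<tau>)\<bar> \<le> 3 * \<delta>"
    if \<sigma>\<tau>: "\<sigma> \<in> DY" "\<tau> \<in> DY" for \<sigma> \<tau>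
  proof -
    obtain u v where u: "0 \<le> u" "dgm_edist \<infinity> dY B \<sigma> \<tau> = ennreal u"
      and v: "0 \<le> v" "dgm_edist \<infinity> dX A (push_dgm \<sigma>) (push_dgm \<tau>) = ennreal v"
      using fin[OF \<sigma>\<tau>] finX[OF \<sigma>\<tau>] by (metis ennreal_cases infinity_ennreal_def less_irrefl)
    have "v \<le> u + \<delta>" "u \<le> v + 3 * \<delta>"
      using edist[OF \<sigma>\<tau>] u v \<delta> by (simp_all del: ennreal_plus add: ennreal_plus[symmetric])
    with u v \<delta> show ?thesis
      by (simp add: dgm_dist_def)
  qed
  have "dgm_edist \<infinity> dX A (empty_dgm X A) (empty_dgm X A) \<le> ennreal 0"
    by (subst (1) empty_dgm_def) (simp only: dgm_edist_empty_le_iff[OF pairX zero_cmultisets order_refl] zero_cmultisets)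
  then show "hausdorff_dist (dgm_dist \<infinity> dX A) (push_dgm ` {empty_dgm Y B}) {empty_dgm X A} \<le> ennreal (3 * \<delta>)"
    by (simp add: push_empty_dgm hausdorff_dist_def dist_to_set_def dgm_dist_def)
  show "cball_set (dgm_space \<infinity> X dX A) (dgm_dist \<infinity> dX A) R {empty_dgm X A}
      \<subseteq> cball_set (dgm_space \<infinity> X dX A) (dgm_dist \<infinity> dX A) (3 * \<delta>) (push_dgm ` DY)"
  proof
    fix \<tau> assume \<tau>: "\<tau> \<in> cball_set (dgm_space \<infinity> X dX A) (dgm_dist \<infinity> dX A) R {empty_dgm X A}"
    then obtain t where t: "t \<in> cmultisets (cball_set X dX R A)" "\<tau> = dgm_rel X A `` {t}"
      using cball_empty_dgm_iff[OF pairX R] by metis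
    obtain s where s: "s \<in> cmultisets N"
      and le: "dgm_edist \<infinity> dX A \<tau> (dgm_rel X A `` {push f s}) \<le> ennreal \<delta>"
      using dgm_dense_ball[OF t(1)] t(2) by metis
    have sDY: "dgm_rel Y B `` {s} \<in> DY"
      using s DY by blast
    have "dgm_dist \<infinity> dX A \<tau> (push_dgm (dgm_rel Y B `` {s})) \<le> \<delta>"
      using le \<delta> by (simp add: dgm_dist_def push_dgm_class[OF s] enn2real_leI)
    then have "dist_to_set (dgm_dist \<infinity> dX A) \<tau> (push_dgm ` DY) \<le> ennreal (3 * \<delta>)"
      using sDY \<delta> by (intro dist_to_set_leI[of "push_dgm (dgm_rel Y B `` {s})"]) auto
    with \<tau> show "\<tau> \<in> cball_set (dgm_space \<infinity> X dX A) (dgm_dist \<infinity> dX A) (3 * \<delta>) (push_dgm ` DY)"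
      by (simp add: cball_set_def)
  qed
qed

end

section \<open>Continuity of bottleneck diagram spaces\<close>

text \<open>
  Gromov--Hausdorff convergence only puts \<open>f ` B\<close> close to \<open>A\<close>. Each point of
  \<open>B\<close> is therefore sent to a point of \<open>A\<close> within \<open>2 * \<epsilon>\<close> of its
  former image; the factor \<open>2\<close> is there because the distance to \<open>A\<close> need not be
  attained. Two such moves add \<open>4 * \<epsilon>\<close> to the distortion.
\<close>

lemma metric_pair_approximation_adjust:
  fixes f :: "'a \<Rightarrow> 'b"
  assumes pairY: "metric_pair Y dY B" and pairX: "metric_pair X dX A"
    and R: "0 \<le> R" and \<epsilon>: "0 < \<epsilon>"
    and f_X: "f ` cball_set Y dY R B \<subseteq> X"
    and dist: "\<And>x y. x \<in> cball_set Y dY R B \<Longrightarrow> y \<in> cball_set Y dY R B \<Longrightarrow>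
          \<bar>dY x y - dX (f x) (f y)\<bar> \<le> \<epsilon>"
    and haus: "hausdorff_dist dX (f ` B) A \<le> ennreal \<epsilon>"
    and ball: "cball_set X dX R A \<subseteq> cball_set X dX \<epsilon> (f ` cball_set Y dY R B)"
  shows "\<exists>f' :: 'a \<Rightarrow> 'b. metric_pair_approximation Y dY B X dX A R (5 * \<epsilon>) f'"
proof -
  interpret X: Metric_space X dX
    using pairX by (simp add: metric_pair_def)
  let ?N = "cball_set Y dY R B"
  have B_N: "B \<subseteq> ?N"
    using pairY R by (rule subset_cball_set)
  note A_X = metric_pair_subset[OF pairX]
  have fB_A: "dist_to_set dX (f b) A \<le> ennreal \<epsilon>" if "b \<in> B" for b
  proof -
    have "dist_to_set dX (f b) A \<le> hausdorff_dist dX (f ` B) A"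
      unfolding hausdorff_dist_def using that by (intro max.coboundedI1 SUP_upper) auto
    then show ?thesis using haus by (rule order_trans)
  qed
  have A_fB: "dist_to_set dX a (f ` B) \<le> ennreal \<epsilon>" if "a \<in> A" for a
  proof -
    have "dist_to_set dX a (f ` B) \<le> hausdorff_dist dX (f ` B) A"
      unfolding hausdorff_dist_def using that by (intro max.coboundedI2 SUP_upper)
    then show ?thesis using haus by (rule order_trans)
  qed
  have "\<exists>a\<in>A. dX (f b) a < 2 * \<epsilon>" if "b \<in> B" for b
    using dist_to_set_nearE[OF fB_A[OF that], of "2 * \<epsilon>"] \<epsilon> by auto
  then obtain g where g: "\<And>b. b \<in> B \<Longrightarrow> g b \<in> A \<and> dX (f b) (g b) < 2 * \<epsilon>"
    by metis
  define f' where "f' x = (if x \<in> B then g x else f x)" for x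
  have f'_X: "f' x \<in> X" and f_X': "f x \<in> X" if "x \<in> ?N" for x
    using that f_X g A_X by (auto simp: f'_def)
  have near: "dX (f x) (f' x) \<le> 2 * \<epsilon>" if "x \<in> ?N" for x
    using g[of x] f_X'[OF that] \<epsilon> by (auto simp: f'_def)
  have tri: "dX y (f' x) \<le> 5 * \<epsilon>" if "y \<in> X" "x \<in> ?N" "dX y (f x) < 2 * \<epsilon>" for x y
    using X.triangle[OF that(1) f_X'[OF that(2)] f'_X[OF that(2)]] near[OF that(2)] that(3) \<epsilon> by simp
  have "metric_pair_approximation Y dY B X dX A R (5 * \<epsilon>) f'"
  proof
    show "f' ` ?N \<subseteq> X"
      using f'_X by auto
    show "f' ` B \<subseteq> A"
      using g by (auto simp: f'_def)
  next
    fix x y assume xy: "x \<in> ?N" "y \<in> ?N"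
    have "dX (f' x) (f' y) \<le> dX (f x) (f' x) + dX (f x) (f y) + dX (f y) (f' y)"
      using X.triangle[OF f'_X[OF xy(1)] f_X'[OF xy(1)] f'_X[OF xy(2)]]
        X.triangle[OF f_X'[OF xy(1)] f_X'[OF xy(2)] f'_X[OF xy(2)]] X.commute[of "f x" "f' x"]
      by simp
    moreover have "dX (f x) (f y) \<le> dX (f x) (f' x) + dX (f' x) (f' y) + dX (f y) (f' y)"
      using X.triangle[OF f_X'[OF xy(1)] f'_X[OF xy(1)] f_X'[OF xy(2)]]
        X.triangle[OF f'_X[OF xy(1)] f'_X[OF xy(2)] f_X'[OF xy(2)]] X.commute[of "f y" "f' y"]
      by simp
    ultimately show "\<bar>dY x y - dX (f' x) (f' y)\<bar> \<le> 5 * \<epsilon>"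
      using near[OF xy(1)] near[OF xy(2)] dist[OF xy] by linarith
  next
    fix a assume a: "a \<in> A"
    obtain b where "b \<in> B" "dX a (f b) < 2 * \<epsilon>"
      using dist_to_set_nearE[OF A_fB[OF a], of "2 * \<epsilon>"] \<epsilon> by auto
    then show "\<exists>b\<in>B. dX a (f' b) \<le> 5 * \<epsilon>"
      using tri[of a b] a A_X B_N by blast
  next
    fix y assume "y \<in> cball_set X dX R A"
    then have y: "y \<in> X" "dist_to_set dX y (f ` ?N) \<le> ennreal \<epsilon>"
      using ball by (auto simp: cball_set_def)
    obtain x where "x \<in> ?N" "dX y (f x) < 2 * \<epsilon>"
      using dist_to_set_nearE[OF y(2), of "2 * \<epsilon>"] \<epsilon> by auto
    then show "\<exists>x\<in>?N. dX y (f' x) \<le> 5 * \<epsilon>"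
      using tri[of y x] y(1) by blast
  qed (use assms in simp_all)
  then show ?thesis
    by blast
qed

text \<open>
  Adjusting the maps costs a factor \<open>5\<close> in the errors, passing to diagrams a factor
  \<open>3\<close>; the radii stay the same.
\<close>

lemma dgm_space_infinity_continuous:
  assumes pairs: "\<And>i. metric_pair (Xs i) (ds i) (As i)" and pair: "metric_pair X d A"
    and gh: "gh_converges Xs ds As X d A"
  shows "pointed_gh_converges
    (\<lambda>i. dgm_space \<infinity> (Xs i) (ds i) (As i)) (\<lambda>i. dgm_dist \<infinity> (ds i) (As i))
    (\<lambda>i. empty_dgm (Xs i) (As i))
    (dgm_space \<infinity> X d A) (dgm_dist \<infinity> d A) (empty_dgm X A)"
proof -
  obtain \<epsilon> R f where \<epsilon>: "\<And>i. 0 < \<epsilon> i" "decseq \<epsilon>" "\<epsilon> \<longlonglongrightarrow> 0"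
    and R: "\<And>i. 0 < R i" "incseq R" "filterlim R at_top sequentially"
    and f: "\<And>i. f i ` cball_set (Xs i) (ds i) (R i) (As i) \<subseteq> X"
      "\<And>i x y. x \<in> cball_set (Xs i) (ds i) (R i) (As i) \<Longrightarrow>
        y \<in> cball_set (Xs i) (ds i) (R i) (As i) \<Longrightarrow> \<bar>ds i x y - d (f i x) (f i y)\<bar> \<le> \<epsilon> i"
      "\<And>i. hausdorff_dist d (f i ` As i) A \<le> ennreal (\<epsilon> i)"
      "\<And>i. cball_set X d (R i) A
        \<subseteq> cball_set X d (\<epsilon> i) (f i ` cball_set (Xs i) (ds i) (R i) (As i))"
    using gh unfolding gh_converges_def by (elim exE conjE) blast
  have "\<exists>f'. metric_pair_approximation (Xs i) (ds i) (As i) X d A (R i) (5 * \<epsilon> i) f'" for i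
    using R(1)[of i] \<epsilon>(1)[of i] f
    by (intro metric_pair_approximation_adjust[OF pairs pair, where f = "f i"]) auto
  then obtain f' where f': "\<And>i. metric_pair_approximation (Xs i) (ds i) (As i) X d A (R i) (5 * \<epsilon> i) (f' i)"
    by metis
  define F where "F i = metric_pair_approximation.push_dgm X A (f' i)" for i
  note F = metric_pair_approximation.push_dgm_approximation[OF f', folded F_def]
  show ?thesis
    unfolding pointed_gh_converges_def gh_converges_def
  proof (rule exI[of _ "\<lambda>i. 3 * (5 * \<epsilon> i)"], rule exI[of _ R], rule exI[of _ F], intro conjI allI ballI)
    show "decseq (\<lambda>i. 3 * (5 * \<epsilon> i))"
      using \<epsilon>(2) by (auto simp: decseq_def)
    show "(\<lambda>i. 3 * (5 * \<epsilon> i)) \<longlonglongrightarrow> 0"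
      by (intro tendsto_mult_right_zero \<epsilon>(3))
  qed (use F R \<epsilon>(1) in auto)
qed


section \<open>Discontinuity for finite exponents\<close>

definition discrete_dist :: "real \<Rightarrow> 'a \<Rightarrow> 'a \<Rightarrow> real" where
  "discrete_dist \<delta> u v = (if u = v then 0 else \<delta>)"

definition copies :: "nat \<Rightarrow> 'a \<Rightarrow> 'a \<Rightarrow> enat" where
  "copies n y v = (if v = y then enat n else 0)"

lemma copies_cmultisets: "y \<in> Y \<Longrightarrow> copies n y \<in> cmultisets Y"
  by (auto simp: copies_def cmultisets_def intro: countable_subset[of _ "{y}"])

lemma occs_copies: "occs (copies n y) = Pair y ` {..<n}"
  by (auto simp: occs_def copies_def split: if_splits)

lemma metric_pair_singleton:
  assumes "Metric_space X d" "a \<in> X"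
  shows "metric_pair X d {a}"
  using assms Metric_space.Hausdorff_space_mtopology[OF assms(1)]
  by (simp add: metric_pair_def closedin_Hausdorff_singleton Metric_space.topspace_mtopology)

lemma metric_pair_discrete: "0 < \<delta> \<Longrightarrow> a \<in> X \<Longrightarrow> metric_pair X (discrete_dist \<delta>) {a}"
  by (rule metric_pair_singleton) (unfold_locales, auto simp: discrete_dist_def)

lemma metric_pair_point: "metric_pair {z} (\<lambda>_ _. 0) {z}"
  by (rule metric_pair_singleton) (unfold_locales, auto)

lemma ennreal_powr_mono: "0 \<le> a \<Longrightarrow> x \<le> y \<Longrightarrow> ennreal_powr x a \<le> ennreal_powr y a"
  by (auto simp: ennreal_powr_def top_unique less_top intro!: ennreal_leI powr_mono2 enn2real_mono)

lemma dgm_edist_empty_empty: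
  assumes "metric_pair X d A" "p \<noteq> \<infinity>"
  shows "dgm_edist p d A (empty_dgm X A) (empty_dgm X A) = 0"
proof -
  have "dgm_edist p d A (empty_dgm X A) (empty_dgm X A) \<le> mset_dist p d (0 + 0) (0 + 0)"
    unfolding empty_dgm_def dgm_edist_class[OF assms(1) zero_cmultisets zero_cmultisets]
    by (intro INF_INF_lower zero_cmultisets)
  also have "\<dots> \<le> matching_cost p d 0 id"
    unfolding mset_dist_def by (auto intro!: INF_lower)
  also have "\<dots> = 0"
    using assms(2) by (simp add: matching_cost_def occs_def ennreal_powr_def zero_enat_def)
  finally show ?thesis
    by simp
qed

text \<open>
  Only copies of \<open>x\<close> may be added to the two diagrams, so every matching sends each copy
  of \<open>y\<close> to a copy of \<open>x\<close>, which gives the lower bound; it is attained by adding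
  \<open>n\<close> copies of \<open>x\<close> to the empty diagram.
\<close>

lemma dgm_edist_copies:
  fixes x y :: 'a
  assumes "x \<noteq> y" "0 < \<delta>" "1 \<le> r"
  shows "dgm_edist (ereal r) (discrete_dist \<delta>) {x}
      (dgm_rel {x, y} {x} `` {copies n y}) (empty_dgm {x, y} {x}) = ennreal (real n powr (1 / r) * \<delta>)"
    (is "?lhs = ?rhs")
proof (rule antisym)
  let ?d = "discrete_dist \<delta>"
  note pair = metric_pair_discrete[OF \<open>0 < \<delta>\<close>, of x "{x, y}", simplified]
  have edist_eq: "?lhs = (INF \<alpha>\<in>cmultisets {x}. INF \<beta>\<in>cmultisets {x}.
      mset_dist (ereal r) ?d (copies n y + \<alpha>) (0 + \<beta>))"
    unfolding empty_dgm_def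
    by (rule dgm_edist_class[OF pair]) (auto intro: copies_cmultisets)
  have rhs: "ennreal_powr (ennreal (real n * \<delta> powr r)) (1 / r) = ?rhs"
    using assms by (simp add: ennreal_powr_def powr_mult powr_powr)
  let ?K = "Pair y ` {..<n}"
  have K: "finite ?K" "card ?K = n"
    by (auto simp: card_image inj_on_def)
  have sum_K: "(\<Sum>\<^sub>\<infinity>u\<in>?K. ennreal (?d (fst u) (fst (\<phi> u)) powr r)) = ennreal (real n * \<delta> powr r)"
    if "\<And>u. u \<in> ?K \<Longrightarrow> fst (\<phi> u) = x" for \<phi> :: "'a \<times> nat \<Rightarrow> 'a \<times> nat"
  proof -
    have "(\<Sum>\<^sub>\<infinity>u\<in>?K. ennreal (?d (fst u) (fst (\<phi> u)) powr r)) = (\<Sum>u\<in>?K. ennreal (\<delta> powr r))"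
      unfolding infsum_finite[OF K(1)]
      using that assms(1) by (intro sum.cong) (auto simp: discrete_dist_def)
    also have "\<dots> = ennreal (real n * \<delta> powr r)"
      using K(2) by (simp add: ennreal_mult ennreal_of_nat_eq_real_of_nat)
    finally show ?thesis .
  qed
  show "?rhs \<le> ?lhs"
    unfolding edist_eq mset_dist_def
  proof (intro INF_greatest)
    fix \<alpha> \<beta> \<phi> assume \<beta>: "\<beta> \<in> cmultisets {x}"
      and "\<phi> \<in> {\<phi>. bij_betw \<phi> (occs (copies n y + \<alpha>)) (occs (0 + \<beta>))}"
    then have \<phi>: "bij_betw \<phi> (occs (copies n y + \<alpha>)) (occs \<beta>)"
      by simp
    have "enat k < copies n y y + \<alpha> y" if "k < n" for k
      using that by (cases "\<alpha> y") (auto simp: copies_def)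
    then have K_sub: "?K \<subseteq> occs (copies n y + \<alpha>)"
      by (auto simp: occs_def)
    then have "fst (\<phi> u) = x" if "u \<in> ?K" for u
      using that bij_betwE[OF \<phi>] fst_occs[OF \<beta>] by blast
    then have "ennreal (real n * \<delta> powr r) = (\<Sum>\<^sub>\<infinity>u\<in>?K. ennreal (?d (fst u) (fst (\<phi> u)) powr r))"
      by (rule sum_K[symmetric])
    also have "\<dots> \<le> (\<Sum>\<^sub>\<infinity>u\<in>occs (copies n y + \<alpha>). ennreal (?d (fst u) (fst (\<phi> u)) powr r))"
      using K_sub by (intro infsum_mono_neutral nonneg_summable_on_complete) auto
    finally show "?rhs \<le> matching_cost (ereal r) ?d (copies n y + \<alpha>) \<phi>"
      unfolding matching_cost_def rhs[symmetric] using assms(3) by (auto intro: ennreal_powr_mono)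
  qed
  define \<phi> where "\<phi> = (\<lambda>(v :: 'a, k :: nat). (x, k))"
  have "bij_betw \<phi> (occs (copies n y)) (occs (copies n x))"
    unfolding occs_copies by (auto simp: bij_betw_def inj_on_def \<phi>_def image_image)
  then have "mset_dist (ereal r) ?d (copies n y) (copies n x) \<le> matching_cost (ereal r) ?d (copies n y) \<phi>"
    unfolding mset_dist_def by (intro INF_lower) simp
  also have "\<dots> = ?rhs"
    unfolding matching_cost_def occs_copies rhs[symmetric]
    by (subst sum_K[symmetric, of \<phi>]) (auto simp: \<phi>_def)
  finally have "mset_dist (ereal r) ?d (copies n y + 0) (0 + copies n x) \<le> ?rhs"
    by simp
  moreover have "?lhs \<le> mset_dist (ereal r) ?d (copies n y + 0) (0 + copies n x)"
    unfolding edist_eq by (intro INF_INF_lower zero_cmultisets copies_cmultisets) simp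
  ultimately show "?lhs \<le> ?rhs"
    by simp
qed

text \<open>
  Taking \<open>n\<close> to be \<open>(1/\<delta>)\<^sup>r\<close> rounded up, the value is at least \<open>1\<close>, and
  rounding at most doubles \<open>n\<close>.
\<close>

lemma exists_copies_of_size_one:
  assumes "0 < \<delta>" "\<delta> \<le> 1" "1 \<le> r"
  obtains n :: nat where "1 \<le> real n powr (1 / r) * \<delta>" "real n powr (1 / r) * \<delta> \<le> 2"
proof
  define q where "q = (1 / \<delta>) powr r"
  let ?n = "nat \<lceil>q\<rceil>"
  have q: "1 \<le> q"
    using assms by (simp add: q_def ge_one_powr_ge_zero)
  have qr: "q powr (1 / r) = 1 / \<delta>"
    using assms by (simp add: q_def powr_powr)
  have "q powr (1 / r) \<le> real ?n powr (1 / r)"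
    using q assms by (intro powr_mono2) auto
  then show "1 \<le> real ?n powr (1 / r) * \<delta>"
    using assms qr by (simp add: field_simps)
  have "real ?n \<le> 2 * q"
    using q by linarith
  then have "real ?n powr (1 / r) \<le> (2 * q) powr (1 / r)"
    using assms by (intro powr_mono2) auto
  also have "\<dots> = 2 powr (1 / r) * (1 / \<delta>)"
    using q qr by (simp add: powr_mult)
  also have "\<dots> \<le> 2 powr 1 * (1 / \<delta>)"
    using assms by (intro mult_right_mono powr_mono) auto
  finally show "real ?n powr (1 / r) * \<delta> \<le> 2"
    using assms by (simp add: field_simps)
qed

lemma discrete_gh_converges_point:
  assumes "x \<in> Y"
  shows "gh_converges (\<lambda>_. Y) (\<lambda>i. discrete_dist (1 / real (Suc i))) (\<lambda>_. {x}) {z} (\<lambda>_ _. 0) {z}"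
  unfolding gh_converges_def
proof (rule exI[of _ "\<lambda>i. 1 / real (Suc i)"], rule exI[of _ "\<lambda>i. real (Suc i)"],
    rule exI[of _ "\<lambda>_ _. z"], intro conjI allI)
  show "(\<lambda>i. 1 / real (Suc i)) \<longlonglongrightarrow> 0"
    by (rule lim_1_over_n[THEN LIMSEQ_Suc])
  show "decseq (\<lambda>i. 1 / real (Suc i))"
    by (auto simp: decseq_def intro: divide_left_mono)
  show "filterlim (\<lambda>i. real (Suc i)) at_top sequentially"
    by (rule filterlim_compose[OF filterlim_real_sequentially filterlim_Suc])
  fix i
  let ?N = "cball_set Y (discrete_dist (1 / real (Suc i))) (real (Suc i)) {x}"
  have "x \<in> ?N"
    using subset_cball_set[OF metric_pair_discrete[of "1 / real (Suc i)" x Y], of "real (Suc i)"] assms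
    by simp
  then have "dist_to_set (\<lambda>_ _. 0) z ((\<lambda>_. z) ` ?N) \<le> ennreal (1 / real (Suc i))"
    by (intro dist_to_set_leI[of z]) auto
  then show "cball_set {z} (\<lambda>_ _. 0) (real (Suc i)) {z} \<subseteq> cball_set {z} (\<lambda>_ _. 0) (1 / real (Suc i)) ((\<lambda>_. z) ` ?N)"
    by (auto simp: cball_set_def)
qed (auto simp: incseq_def discrete_dist_def hausdorff_dist_def dist_to_set_def)

lemma dgms_point_eq:
  assumes "\<sigma> \<in> dgms {z} {z}"
  shows "\<sigma> = empty_dgm {z} {z}"
proof -
  obtain s where s: "s \<in> cmultisets {z}" "\<sigma> = dgm_rel {z} {z} `` {s}"
    using assms by (auto simp: dgms_def elim: quotientE)
  have "s + 0 = 0 + s"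
    by simp
  then have "(s, 0) \<in> dgm_rel {z} {z}"
    using s(1) zero_cmultisets[of "{z}"] unfolding dgm_rel_def by blast
  then show ?thesis
    unfolding s(2) empty_dgm_def by (rule equiv_class_eq[OF equiv_dgm_rel])
qed

text \<open>
  Over a point all diagrams coincide, so an approximation with error less than \<open>1\<close> and
  radius at least \<open>2\<close> cannot have in its domain a diagram at distance between
  \<open>1\<close> and \<open>2\<close> from the empty one. However close the two points are, suitably many
  copies of one of them form such a diagram.
\<close>

lemma dgm_space_discontinuous_finite:
  fixes x y :: 'a and z :: 'b
  assumes "x \<noteq> y" "1 \<le> r"
  shows "\<not> pointed_gh_converges
    (\<lambda>i. dgm_space (ereal r) {x, y} (discrete_dist (1 / real (Suc i))) {x})
    (\<lambda>i. dgm_dist (ereal r) (discrete_dist (1 / real (Suc i))) {x}) (\<lambda>i. empty_dgm {x, y} {x})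
    (dgm_space (ereal r) {z} (\<lambda>_ _. 0) {z}) (dgm_dist (ereal r) (\<lambda>_ _. 0) {z}) (empty_dgm {z} {z})"
  (is "\<not> pointed_gh_converges ?D ?d ?e ?D' ?d' ?e'")
proof
  assume "pointed_gh_converges ?D ?d ?e ?D' ?d' ?e'"
  then obtain \<epsilon> R f where \<epsilon>: "\<epsilon> \<longlonglongrightarrow> 0" and R: "filterlim R at_top sequentially"
    and f: "\<And>i. f i ` cball_set (?D i) (?d i) (R i) {?e i} \<subseteq> ?D'"
    and dist: "\<And>i \<sigma> \<tau>. \<sigma> \<in> cball_set (?D i) (?d i) (R i) {?e i} \<Longrightarrow>
        \<tau> \<in> cball_set (?D i) (?d i) (R i) {?e i} \<Longrightarrow> \<bar>?d i \<sigma> \<tau> - ?d' (f i \<sigma>) (f i \<tau>)\<bar> \<le> \<epsilon> i"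
    unfolding pointed_gh_converges_def gh_converges_def by (elim exE conjE) blast
  have "\<forall>\<^sub>F i in sequentially. \<epsilon> i < 1 \<and> 2 \<le> R i"
    using order_tendstoD(2)[OF \<epsilon>, of 1] R by (auto simp: filterlim_at_top intro: eventually_conj)
  then obtain i where i: "\<epsilon> i < 1" "2 \<le> R i"
    using eventually_happens'[OF sequentially_bot] by blast
  define \<delta> where "\<delta> = 1 / real (Suc i)"
  have \<delta>: "0 < \<delta>" "\<delta> \<le> 1"
    by (auto simp: \<delta>_def)
  obtain n :: nat where n: "1 \<le> real n powr (1 / r) * \<delta>" "real n powr (1 / r) * \<delta> \<le> 2"
    using exists_copies_of_size_one[OF \<delta> assms(2)] by metis
  define \<sigma> where "\<sigma> = dgm_rel {x, y} {x} `` {copies n y}"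
  note edist = dgm_edist_copies[OF assms(1) \<delta>(1) assms(2), of n, folded \<sigma>_def]
  have "\<sigma> \<in> dgms {x, y} {x}"
    unfolding \<sigma>_def dgms_def by (intro quotientI copies_cmultisets) simp
  then have "\<sigma> \<in> ?D i"
    unfolding dgm_space_def using edist by (simp add: \<delta>_def)
  moreover have d\<sigma>: "?d i \<sigma> (?e i) = real n powr (1 / r) * \<delta>"
    unfolding dgm_dist_def using edist \<delta>(1) by (simp add: \<delta>_def)
  ultimately have \<sigma>: "\<sigma> \<in> cball_set (?D i) (?d i) (R i) {?e i}"
    using n(2) i(2) by (auto simp: cball_set_def intro!: dist_to_set_leI)
  have "metric_pair {x, y} (discrete_dist \<delta>) {x}"
    using \<delta>(1) by (intro metric_pair_discrete) simp_all
  from dgm_edist_empty_empty[OF this, of "ereal r"]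
  have e0: "dgm_edist (ereal r) (discrete_dist (1 / real (Suc i))) {x} (?e i) (?e i) = 0"
    by (simp add: \<delta>_def)
  have "?e i \<in> ?D i"
    unfolding dgm_space_def using e0
    by (auto simp: dgms_def empty_dgm_def intro!: quotientI)
  then have e: "?e i \<in> cball_set (?D i) (?d i) (R i) {?e i}"
    using i(2) e0 by (auto simp: cball_set_def dgm_dist_def intro!: dist_to_set_leI)
  have "f i \<sigma> = ?e'" "f i (?e i) = ?e'"
    using f[of i] \<sigma> e by (auto intro!: dgms_point_eq simp: dgm_space_def)
  then have "?d' (f i \<sigma>) (f i (?e i)) = 0"
    using dgm_edist_empty_empty[OF metric_pair_point[of z], of "ereal r"] by (simp add: dgm_dist_def)
  with dist[OF \<sigma> e] d\<sigma> n(1) i(1) show False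
    by simp
qed

section \<open>The characterization of continuity\<close>

theorem theorem1:
  fixes p :: ereal
  assumes "1 \<le> p"
    and "\<exists>x y :: 'a. x \<noteq> y"
  shows
    "(\<forall>(Xs :: nat \<Rightarrow> 'a set) ds As (X :: 'b set) d A.
        (\<forall>i. metric_pair (Xs i) (ds i) (As i)) \<and> metric_pair X d A \<and>
        gh_converges Xs ds As X d A \<longrightarrow>
        pointed_gh_converges
          (\<lambda>i. dgm_space p (Xs i) (ds i) (As i)) (\<lambda>i. dgm_dist p (ds i) (As i))
          (\<lambda>i. empty_dgm (Xs i) (As i))
          (dgm_space p X d A) (dgm_dist p d A) (empty_dgm X A))
     \<longleftrightarrow> p = \<infinity>"
    (is "?continuous \<longleftrightarrow> _")
proof
  assume continuous: ?continuous
  show "p = \<infinity>"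
  proof (rule ccontr)
    assume "p \<noteq> \<infinity>"
    with assms(1) obtain r where p: "p = ereal r" and r: "1 \<le> r"
      by (cases p) auto
    obtain x y :: 'a where xy: "x \<noteq> y"
      using assms(2) by blast
    fix z :: 'b
    let ?d = "\<lambda>i. discrete_dist (1 / real (Suc i)) :: 'a \<Rightarrow> 'a \<Rightarrow> real"
    have "metric_pair {x, y} (?d i) {x}" for i
      by (rule metric_pair_discrete) auto
    moreover have "gh_converges (\<lambda>_. {x, y}) ?d (\<lambda>_. {x}) {z} (\<lambda>_ _. 0) {z}"
      by (rule discrete_gh_converges_point) simp
    ultimately show False
      using continuous[rule_format, of "\<lambda>_. {x, y}" ?d "\<lambda>_. {x}" "{z}" "\<lambda>_ _. 0" "{z}"]
        metric_pair_point[of z] dgm_space_discontinuous_finite[OF xy r, of z]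
      unfolding p by blast
  qed
next
  assume "p = \<infinity>"
  then show ?continuous
    using dgm_space_infinity_continuous by blast
qed

end
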